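(* Let $p\ge1$ be an integer and $Q>0$. Let $\{\lambda(k)\}_{k\ge1}$ be a probability distribution on $\{1,2,\dots\}$ with $\lambda(k)\ge a\,e^{-\gamma k}$ for all $k\ge1$, for some constants $a,\gamma>0$. Let $\pi$ be the restriction to $E_p(Q)$ of the sieve prior $\mu=\sum_{k=1}^\infty\lambda(k)\mu_k$, i.e. $\pi(\cdot)=\mu(\cdot\cap E_p(Q))/\mu(E_p(Q))$, where $\mu_k$ is the Gaussian product measure defined in the context, and let $\Pi$ be the prior induced by $\pi$ on $\mathscr F=\{f_{\boldsymbol\theta}:\boldsymbol\theta\in E_p(Q)\}$. If $\boldsymbol\theta_0\in E_p(Q)$ and $P_0=P_{\boldsymbol\theta_0}$, then for a sufficiently large constant $M>0$, $$\Pi\big(\{P_{\boldsymbol\theta}:\ d_{\mathrm H}(P_0,P_{\boldsymbol\theta})>Mn^{-p/(2p+1)}\}\,\big|\,X_1,\dots,X_n\big)\to0\quad\text{as }n\to\infty,$$ $P_0^\infty$-almost surely.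
   Context: Trigonometric system on $[0,1]$: $\phi_0\equiv1$ and, for $k\ge1$, $\phi_{2k-1}(x)=\sqrt2\sin(2\pi kx)$, $\phi_{2k}(x)=\sqrt2\cos(2\pi kx)$. Put $v_0=0$ and, for $j\ge1$, $v_j=j+1$ if $j$ is odd, $v_j=j$ if $j$ is even. The Sobolev ellipsoid is $E_p(Q)=\{\boldsymbol\theta\in\ell_2:\sum_{j=0}^\infty v_j^{2p}\theta_j^2<Q\}$. For $\boldsymbol\theta\in E_p(Q)$, $P_{\boldsymbol\theta}$ is the probability measure on $[0,1]$ with Lebesgue density $$f_{\boldsymbol\theta}(x)=\frac{\exp\{\sum_{j=1}^\infty\theta_j\phi_j(x)\}}{\int_0^1\exp\{\sum_{j=1}^\infty\theta_j\phi_j(t)\}\,dt},\qquad x\in[0,1].$$ The Hellinger distance is $d_{\mathrm H}(P_{\boldsymbol\theta'},P_{\boldsymbol\theta})=\{\int_0^1(\sqrt{f_{\boldsymbol\theta'}}-\sqrt{f_{\boldsymbol\theta}})^2\,dx\}^{1/2}$. For $k\ge1$, $\mu_k$ is the probability measure on sequences $(\theta_0,\theta_1,\dots)$ under which the coordinates are independent, $\theta_0\equiv0$, $\theta_j\sim N(0,v_j^{-(2p+1)})$ for $j=1,\dots,k$, and $\theta_j\equiv0$ for all $j>k$. The observations $X_1,X_2,\dots$ are i.i.d. from $P_0$; $P_0^\infty$ is the infinite product measure of $P_0$; the posterior is given by Bayes' formula: $\Pi(C\mid X_1,\dots,X_n)=\int_{\{\boldsymbol\theta:P_{\boldsymbol\theta}\in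 C\}}\prod_{i=1}^nf_{\boldsymbol\theta}(X_i)\,\pi(d\boldsymbol\theta)\big/\int\prod_{i=1}^nf_{\boldsymbol\theta}(X_i)\,\pi(d\boldsymbol\theta)$. *)

theory Defs
  imports "HOL-Probability.Probability"
begin

definition trig_basis :: "nat \<Rightarrow> real \<Rightarrow> real" where
  "trig_basis j x =
     (if j = 0 then 1
      else if odd j then sqrt 2 * sin (2 * pi * real ((j + 1) div 2) * x)
      else sqrt 2 * cos (2 * pi * real (j div 2) * x))"

lemma trig_basis_simps:
  "trig_basis 0 x = 1"
  "k \<ge> 1 \<Longrightarrow> trig_basis (2 * k - 1) x = sqrt 2 * sin (2 * pi * real k * x)"
  "k \<ge> 1 \<Longrightarrow> trig_basis (2 * k) x = sqrt 2 * cos (2 * pi * real k * x)"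
  by (auto simp: trig_basis_def)

definition freq_weight :: "nat \<Rightarrow> nat" where
  "freq_weight j = (if odd j then j + 1 else j)"

text \<open>The weight at \<open>j = 0\<close> vanishes, so square summability together with the bound leaves
  \<open>\<theta> 0\<close> unrestricted.  Summability of the weighted series is stated because \<open>suminf\<close> of a
  divergent series is an unspecified real number.\<close>

definition sobolev_ellipsoid :: "nat \<Rightarrow> real \<Rightarrow> (nat \<Rightarrow> real) set" where
  "sobolev_ellipsoid p Q =
     {\<theta>. summable (\<lambda>j. (\<theta> j)\<^sup>2) \<and>
          summable (\<lambda>j. real (freq_weight j) ^ (2 * p) * (\<theta> j)\<^sup>2) \<and>
          (\<Sum>j. real (freq_weight j) ^ (2 * p) * (\<theta> j)\<^sup>2) < Q}"

definition unit_lborel :: "real measure" where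
  "unit_lborel = restrict_space lborel {0..1}"

definition log_series :: "(nat \<Rightarrow> real) \<Rightarrow> real \<Rightarrow> real" where
  "log_series \<theta> x = (\<Sum>j. \<theta> (Suc j) * trig_basis (Suc j) x)"

definition exp_density :: "(nat \<Rightarrow> real) \<Rightarrow> real \<Rightarrow> real" where
  "exp_density \<theta> x = exp (log_series \<theta> x) / (\<integral>t. exp (log_series \<theta> t) \<partial>unit_lborel)"

definition exp_model :: "(nat \<Rightarrow> real) \<Rightarrow> real measure" where
  "exp_model \<theta> = density unit_lborel (\<lambda>x. ennreal (exp_density \<theta> x))"

text \<open>The Hellinger distance of two laws on the unit interval, in terms of their densities.\<close>

definition hellinger :: "(real \<Rightarrow> real) \<Rightarrow> (real \<Rightarrow> real) \<Rightarrow> real" where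
  "hellinger f g = sqrt (\<integral>x. (sqrt (f x) - sqrt (g x))\<^sup>2 \<partial>unit_lborel)"

text \<open>\<open>normal_density\<close> takes the standard deviation, whence the square root of the variance.\<close>

definition sieve_coord :: "nat \<Rightarrow> nat \<Rightarrow> nat \<Rightarrow> real measure" where
  "sieve_coord p k j =
     (if 1 \<le> j \<and> j \<le> k
      then density lborel
             (\<lambda>x. ennreal (normal_density 0 (sqrt (1 / real (freq_weight j) ^ (2 * p + 1))) x))
      else return borel 0)"

definition sieve_component :: "nat \<Rightarrow> nat \<Rightarrow> (nat \<Rightarrow> real) measure" where
  "sieve_component p k = PiM UNIV (sieve_coord p k)"

definition sieve_prior :: "nat \<Rightarrow> nat pmf \<Rightarrow> (nat \<Rightarrow> real) measure" where
  "sieve_prior p lam = measure_pmf lam \<bind> sieve_component p"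

lemma sets_sieve_component [simp]:
  "sets (sieve_component p k) = sets (PiM UNIV (\<lambda>_. borel))"
  unfolding sieve_component_def by (intro sets_PiM_cong) (auto simp: sieve_coord_def)

lemma prob_space_sieve_coord: "prob_space (sieve_coord p k j)"
  unfolding sieve_coord_def
  by (auto simp: freq_weight_def intro!: prob_space_normal_density prob_space_return)

lemma prob_space_sieve_component: "prob_space (sieve_component p k)"
  unfolding sieve_component_def by (intro prob_space_PiM prob_space_sieve_coord)

lemma emeasure_sieve_prior:
  assumes "A \<in> sets (PiM UNIV (\<lambda>_. borel))"
  shows "emeasure (sieve_prior p lam) A =
           (\<Sum>k. ennreal (pmf lam k) * emeasure (sieve_component p k) A)"
proof -
  have "sieve_component p \<in> measurable (measure_pmf lam)
          (subprob_algebra (PiM UNIV (\<lambda>_. borel)))"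
    by (auto simp: space_subprob_algebra prob_space_sieve_component prob_space_imp_subprob_space)
  then have "emeasure (sieve_prior p lam) A =
      (\<integral>\<^sup>+k. emeasure (sieve_component p k) A \<partial>measure_pmf lam)"
    unfolding sieve_prior_def using assms by (intro emeasure_bind) auto
  then show ?thesis
    by (simp add: nn_integral_measure_pmf nn_integral_count_space_nat)
qed

text \<open>Restriction to the ellipsoid, renormalised: \<open>A \<mapsto> \<mu> (A \<inter> E) / \<mu> E\<close>.\<close>

definition restricted_prior :: "nat \<Rightarrow> real \<Rightarrow> nat pmf \<Rightarrow> (nat \<Rightarrow> real) measure" where
  "restricted_prior p Q lam = uniform_measure (sieve_prior p lam) (sobolev_ellipsoid p Q)"

text \<open>Bayes' formula for a prior \<open>\<nu>\<close> carried by the parameter set \<open>\<Theta>\<close>, with \<open>X i\<close> the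
  \<open>(i + 1)\<close>-st observation and \<open>C\<close> a set of laws.  Parameters outside \<open>\<Theta>\<close> are excluded from the
  numerator explicitly: off \<open>\<Theta>\<close> the series may diverge and \<open>exp_model\<close> carries no meaning.\<close>

definition posterior ::
    "(nat \<Rightarrow> real) set \<Rightarrow> (nat \<Rightarrow> real) measure \<Rightarrow> nat \<Rightarrow> (nat \<Rightarrow> real) \<Rightarrow> real measure set \<Rightarrow> real"
  where
  "posterior \<Theta> \<nu> n X C =
     (LINT \<theta>:{\<theta> \<in> \<Theta>. exp_model \<theta> \<in> C}|\<nu>. (\<Prod>i<n. exp_density \<theta> (X i))) /
     (LINT \<theta>|\<nu>. (\<Prod>i<n. exp_density \<theta> (X i)))"

end

theory Submission
  imports Defs
begin

text \<open>
  Write \<open>y = n powr (1 / (2 * p + 1))\<close>, so that the rate is \<open>\<epsilon> = 1 / y ^ p\<close> and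
  \<open>n * \<epsilon>\<^sup>2 = y\<close>.  Every factor in the argument is an exponential in \<open>y\<close>; the posterior mass of the
  far set is at most \<open>exp (- y) / a\<close> outside an event of probability at most \<open>3 * exp (- y)\<close>, and these
  probabilities are summable in \<open>n\<close>, so the Borel-Cantelli lemma gives almost sure convergence.

  The analysis is elementary because \<open>p \<ge> 1\<close> makes all log-densities over the ellipsoid uniformly
  bounded (\<open>abs_log_series_ellipsoid_le\<close>).  Densities therefore lie between two positive constants,
  and Bessel's inequality for the trigonometric system bounds the distance of two densities in
  \<open>L\<^sup>2\<close> by the \<open>\<ell>\<^sup>2\<close> distance of their parameters (\<open>exp_density_L2_le\<close>).

  One Gaussian estimate yields both prior mass and entropy.  Take \<open>k = \<lceil>y\<rceil>\<close> coordinates.  A box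
  around any point of the ellipsoid, with sides of order \<open>k powr (- p - 1/2)\<close> in the first \<open>k\<close>
  coordinates, has mass at least \<open>exp (- C * k)\<close> under the \<open>k\<close>-th component of the sieve
  (\<open>sieve_box_mass\<close>).  Around the true parameter this is the prior mass of a neighbourhood of radius
  \<open>\<epsilon>\<close>, since \<open>\<lambda>(k)\<close> is at least \<open>a * exp (- \<gamma> * k)\<close>.  Around arbitrary points it shows that at most
  \<open>exp (C * k)\<close> such boxes are disjoint, so that a maximal disjoint family of boxes is an
  \<open>\<epsilon>\<close>-net of exponential size for any subset of the ellipsoid (\<open>finite_net_of_box_mass\<close>).

  The denominator of the posterior is bounded below (\<open>mixture_likelihood_lower_tail\<close>) through the
  expectation of the inverse likelihood ratio, a power of one plus a chi-square distance.  The
  numerator is cut into the cells of a net, and each cell is treated by two applications of Markov's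
  inequality (\<open>mixture_likelihood_upper_tail\<close>): the likelihood ratio of the centre of the cell is
  exponentially small because of the Hellinger affinity, and the average over the cell relative to
  the centre has moderate expectation because the cell is small compared with its Hellinger distance
  from the truth, once \<open>M\<close> is large.
\<close>

section \<open>The trigonometric system on the unit interval\<close>

lemma space_unit_lborel [simp]: "space unit_lborel = {0..1}"
  by (simp add: unit_lborel_def space_restrict_space)

lemma emeasure_space_unit_lborel: "emeasure unit_lborel (space unit_lborel) = 1"
  by (simp add: unit_lborel_def emeasure_restrict_space space_restrict_space)

lemma prob_space_unit_lborel: "prob_space unit_lborel"
  by (rule prob_spaceI) (rule emeasure_space_unit_lborel)

interpretation unit: prob_space unit_lborel
  by (rule prob_space_unit_lborel)

lemma measurable_unit_lborel_real:
  "f \<in> borel_measurable borel \<Longrightarrow> f \<in> borel_measurable unit_lborel"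
  unfolding unit_lborel_def by (intro measurable_restrict_space1) simp

lemma trig_basis_measurable [measurable]: "trig_basis j \<in> borel_measurable borel"
  unfolding trig_basis_def by measurable

lemma abs_trig_basis_le: "\<bar>trig_basis j x\<bar> \<le> sqrt 2"
proof -
  have "(1::real) \<le> sqrt 2" by simp
  then show ?thesis
    by (auto simp: trig_basis_def abs_mult intro: mult_left_le)
qed

lemma integral_unit_lborel_eq:
  fixes f F :: "real \<Rightarrow> real"
  assumes F: "\<And>x. (F has_real_derivative f x) (at x)" and c: "continuous_on UNIV f"
  shows "(\<integral>x. f x \<partial>unit_lborel) = F 1 - F 0"
proof -
  have "(\<integral>x. f x \<partial>unit_lborel) = (\<integral>x. indicator {0..1} x *\<^sub>R f x \<partial>lborel)"
    unfolding unit_lborel_def by (rule integral_restrict_space) simp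
  also have "\<dots> = F 1 - F 0"
    by (rule integral_FTC_atLeastAtMost)
      (auto intro!: has_field_derivative_at_within F continuous_on_subset[OF c]
       simp flip: has_real_derivative_iff_has_vector_derivative)
  finally show ?thesis .
qed

lemma integral_cos_int:
  fixes m :: int and c :: real
  shows "(\<integral>x. cos (2 * pi * of_int m * x - c) \<partial>unit_lborel) = (if m = 0 then cos c else 0)"
proof (cases "m = 0")
  case True
  then show ?thesis using unit.prob_space by simp
next
  case False
  define w where "w = 2 * pi * of_int m"
  have w: "w \<noteq> 0" using False by (simp add: w_def)
  have "(\<integral>x. cos (w * x - c) \<partial>unit_lborel) = sin (w * 1 - c) / w - sin (w * 0 - c) / w"
    by (rule integral_unit_lborel_eq)
      (use w in \<open>auto intro!: derivative_eq_intros continuous_intros simp: field_simps\<close>)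
  also have "sin (w * 1 - c) = sin (- c)"
    unfolding w_def sin_diff by (simp add: sin_integer_2pi cos_integer_2pi)
  finally show ?thesis using False by (simp add: w_def)
qed

definition trig_freq :: "nat \<Rightarrow> nat" where "trig_freq j = (j + 1) div 2"
definition trig_phase :: "nat \<Rightarrow> real" where "trig_phase j = (if odd j then pi / 2 else 0)"

lemma trig_basis_eq_cos:
  assumes "j \<ge> 1"
  shows "trig_basis j x = sqrt 2 * cos (2 * pi * real (trig_freq j) * x - trig_phase j)"
  using assms by (auto simp: trig_basis_def trig_freq_def trig_phase_def cos_diff)

text \<open>
  Each basis function is a phase-shifted cosine, so products reduce to two cosines of integer
  frequency by the product-to-sum formula.  When the frequencies agree but the indices differ, the
  phases differ by a quarter period and the constant term vanishes.
\<close>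

lemma trig_basis_orthonormal:
  assumes "i \<ge> 1" "j \<ge> 1"
  shows "(\<integral>x. trig_basis i x * trig_basis j x \<partial>unit_lborel) = (if i = j then 1 else 0)"
proof -
  let ?c = "\<lambda>m c x. cos (2 * pi * of_int m * x - c)"
  let ?k = "int (trig_freq i)" and ?l = "int (trig_freq j)"
  have int: "integrable unit_lborel (?c m c)" for m c
    by (rule unit.integrable_const_bound[where B=1]) (auto intro: measurable_unit_lborel_real)
  have prod: "trig_basis i x * trig_basis j x
      = ?c (?k - ?l) (trig_phase i - trig_phase j) x + ?c (?k + ?l) (trig_phase i + trig_phase j) x"
    for x
  proof -
    have cos_cos: "sqrt 2 * cos u * (sqrt 2 * cos v) = cos (u - v) + cos (u + v)" for u v :: real
      by (simp add: cos_diff cos_add)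
    show ?thesis
      unfolding trig_basis_eq_cos[OF assms(1)] trig_basis_eq_cos[OF assms(2)] cos_cos
      by (intro arg_cong2[where f="(+)"] arg_cong[where f=cos]) (simp_all add: algebra_simps)
  qed
  have "(\<integral>x. trig_basis i x * trig_basis j x \<partial>unit_lborel)
      = (if ?k - ?l = 0 then cos (trig_phase i - trig_phase j) else 0)
        + (if ?k + ?l = 0 then cos (trig_phase i + trig_phase j) else 0)"
    unfolding prod Bochner_Integration.integral_add[OF int int] integral_cos_int ..
  moreover have "?k + ?l \<noteq> 0" using assms by (auto simp: trig_freq_def)
  moreover have "?k = ?l \<Longrightarrow> i \<noteq> j \<Longrightarrow> odd i \<noteq> odd j"
    by (auto simp: trig_freq_def) presburger+
  ultimately show ?thesis
    by (auto simp: trig_phase_def)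
qed

lemma abs_mult_trig_basis_le: "\<bar>c * trig_basis j x\<bar> \<le> sqrt 2 * \<bar>c\<bar>"
  using mult_left_mono[OF abs_trig_basis_le[of j x], of "\<bar>c\<bar>"] by (simp add: abs_mult mult.commute)

lemma summable_log_series:
  assumes "summable (\<lambda>j. \<bar>a (Suc j)\<bar>)"
  shows "summable (\<lambda>j. \<bar>a (Suc j) * trig_basis (Suc j) x\<bar>)"
  by (rule summable_comparison_test'[where N=0 and g="\<lambda>j. sqrt 2 * \<bar>a (Suc j)\<bar>"])
    (use assms abs_mult_trig_basis_le in \<open>auto intro: summable_mult\<close>)

lemma log_series_measurable [measurable]: "log_series a \<in> borel_measurable borel"
  unfolding log_series_def by measurable

lemma log_series_diff:
  assumes "summable (\<lambda>j. \<bar>a (Suc j)\<bar>)" "summable (\<lambda>j. \<bar>b (Suc j)\<bar>)"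
  shows "log_series a x - log_series b x = log_series (\<lambda>j. a j - b j) x"
  unfolding log_series_def
  by (subst suminf_diff) (use summable_log_series[OF assms(1)] summable_log_series[OF assms(2)]
     in \<open>auto intro: summable_rabs_cancel simp: algebra_simps\<close>)

lemma abs_log_series_le:
  assumes "summable (\<lambda>j. \<bar>a (Suc j)\<bar>)"
  shows "\<bar>log_series a x\<bar> \<le> sqrt 2 * (\<Sum>j. \<bar>a (Suc j)\<bar>)"
proof -
  have "\<bar>log_series a x\<bar> \<le> (\<Sum>j. \<bar>a (Suc j) * trig_basis (Suc j) x\<bar>)"
    unfolding log_series_def by (rule summable_rabs[OF summable_log_series[OF assms]])
  also have "\<dots> \<le> (\<Sum>j. sqrt 2 * \<bar>a (Suc j)\<bar>)"
    by (rule suminf_le) (use assms summable_log_series abs_mult_trig_basis_le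
       in \<open>auto intro: summable_mult\<close>)
  finally show ?thesis by (simp add: suminf_mult assms)
qed

lemma integral_trig_poly_sq:
  "(\<integral>x. (\<Sum>j<N. a (Suc j) * trig_basis (Suc j) x)\<^sup>2 \<partial>unit_lborel) = (\<Sum>j<N. (a (Suc j))\<^sup>2)"
proof -
  have int: "integrable unit_lborel (\<lambda>x. a (Suc i) * a (Suc j) * (trig_basis (Suc i) x * trig_basis (Suc j) x))"
    for i j
  proof (rule unit.integrable_const_bound[where B="\<bar>a (Suc i) * a (Suc j)\<bar> * (sqrt 2 * sqrt 2)"])
    show "AE x in unit_lborel. norm (a (Suc i) * a (Suc j) * (trig_basis (Suc i) x * trig_basis (Suc j) x))
      \<le> \<bar>a (Suc i) * a (Suc j)\<bar> * (sqrt 2 * sqrt 2)"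
      unfolding real_norm_def abs_mult
      by (intro AE_I2 mult_mono abs_trig_basis_le) auto
  qed (rule measurable_unit_lborel_real, measurable)
  have "(\<integral>x. (\<Sum>j<N. a (Suc j) * trig_basis (Suc j) x)\<^sup>2 \<partial>unit_lborel)
      = (\<integral>x. (\<Sum>i<N. \<Sum>j<N. a (Suc i) * a (Suc j) * (trig_basis (Suc i) x * trig_basis (Suc j) x)) \<partial>unit_lborel)"
    by (simp add: power2_eq_square sum_product mult_ac)
  also have "\<dots> = (\<Sum>i<N. \<Sum>j<N. a (Suc i) * a (Suc j) * (if i = j then 1 else 0))"
    using int by (simp add: Bochner_Integration.integral_sum trig_basis_orthonormal del: mult_cancel_left)
  also have "\<dots> = (\<Sum>j<N. (a (Suc j))\<^sup>2)"
    by (intro sum.cong refl) (simp add: if_distrib power2_eq_square cong: if_cong)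
  finally show ?thesis .
qed

text \<open>
  Absolute summability gives a uniform bound on the partial sums, so the orthonormality relation
  for trigonometric polynomials passes to the limit by dominated convergence.
\<close>

lemma bessel_log_series:
  assumes a: "summable (\<lambda>j. \<bar>a (Suc j)\<bar>)" and sq: "summable (\<lambda>j. (a (Suc j))\<^sup>2)"
  shows "(\<integral>x. (log_series a x)\<^sup>2 \<partial>unit_lborel) \<le> (\<Sum>j. (a (Suc j))\<^sup>2)"
proof -
  let ?S = "\<lambda>N x. \<Sum>j<N. a (Suc j) * trig_basis (Suc j) x"
  let ?B = "sqrt 2 * (\<Sum>j. \<bar>a (Suc j)\<bar>)"
  have bnd: "\<bar>?S N x\<bar> \<le> ?B" for N x
  proof -
    have "\<bar>?S N x\<bar> \<le> (\<Sum>j<N. sqrt 2 * \<bar>a (Suc j)\<bar>)"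
      by (intro order_trans[OF sum_abs] sum_mono)
        (rule abs_mult_trig_basis_le)
    also have "\<dots> \<le> ?B"
      unfolding sum_distrib_left[symmetric] by (intro mult_left_mono sum_le_suminf a) auto
    finally show ?thesis .
  qed
  have "(\<lambda>N. \<integral>x. (?S N x)\<^sup>2 \<partial>unit_lborel) \<longlonglongrightarrow> (\<integral>x. (log_series a x)\<^sup>2 \<partial>unit_lborel)"
  proof (rule integral_dominated_convergence[where w="\<lambda>_. ?B\<^sup>2"])
    show "AE x in unit_lborel. (\<lambda>N. (?S N x)\<^sup>2) \<longlonglongrightarrow> (log_series a x)\<^sup>2"
      unfolding log_series_def
      by (intro AE_I2 tendsto_power summable_LIMSEQ summable_rabs_cancel[OF summable_log_series[OF a]])
    show "AE x in unit_lborel. norm ((?S N x)\<^sup>2) \<le> ?B\<^sup>2" for N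
      using order_trans[OF bnd abs_ge_self] by (auto intro!: AE_I2 simp: abs_le_square_iff[symmetric])
  qed (auto intro!: measurable_unit_lborel_real)
  then show ?thesis
    unfolding integral_trig_poly_sq
    by (rule LIMSEQ_le_const2) (auto intro!: exI[of _ 0] sum_le_suminf sq)
qed

section \<open>Geometry of the Sobolev ellipsoid\<close>

lemma freq_weight_ge: "j \<le> freq_weight j"
  by (simp add: freq_weight_def)

lemma freq_weight_le: "freq_weight j \<le> 2 * j"
  by (cases j) (auto simp: freq_weight_def)

lemma pred_summable [measurable]:
  fixes f :: "nat \<Rightarrow> 'a \<Rightarrow> real"
  assumes [measurable]: "\<And>i. f i \<in> borel_measurable M"
  shows "Measurable.pred M (\<lambda>x. summable (\<lambda>i. f i x))"
  unfolding summable_iff_convergent Cauchy_convergent_iff[symmetric] by measurable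

lemma sobolev_ellipsoid_measurable [measurable]:
  "sobolev_ellipsoid p Q \<in> sets (PiM UNIV (\<lambda>_. borel))"
proof -
  have "{\<theta> \<in> space (PiM UNIV (\<lambda>_. borel)). summable (\<lambda>j. (\<theta> j)\<^sup>2) \<and>
          summable (\<lambda>j. real (freq_weight j) ^ (2 * p) * (\<theta> j)\<^sup>2) \<and>
          (\<Sum>j. real (freq_weight j) ^ (2 * p) * (\<theta> j)\<^sup>2) < Q} \<in> sets (PiM UNIV (\<lambda>_. borel))"
    by measurable
  then show ?thesis
    by (simp add: sobolev_ellipsoid_def space_PiM)
qed

definition inverse_square_sum :: real where
  "inverse_square_sum = (\<Sum>j. 1 / (real (Suc j))\<^sup>2)"

definition log_bound :: "real \<Rightarrow> real" where
  "log_bound Q = sqrt 2 * ((Q + inverse_square_sum) / 2)"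

text \<open>
  The bound \<open>2 * \<bar>\<theta>\<^sub>j\<bar> \<le> (v\<^sub>j ^ p * \<bar>\<theta>\<^sub>j\<bar>)\<^sup>2 + (1 / v\<^sub>j ^ p)\<^sup>2\<close> separates the Sobolev norm from
  the weights, and \<open>p \<ge> 1\<close> makes the second part summable.
\<close>

lemma sobolev_ellipsoid_abs_summable:
  assumes p: "p \<ge> 1" and \<theta>: "\<theta> \<in> sobolev_ellipsoid p Q"
  shows "summable (\<lambda>j. \<bar>\<theta> (Suc j)\<bar>)"
    and "(\<Sum>j. \<bar>\<theta> (Suc j)\<bar>) \<le> (Q + inverse_square_sum) / 2"
proof -
  let ?w = "\<lambda>j. real (freq_weight j) ^ (2 * p) * (\<theta> j)\<^sup>2"
  let ?q = "\<lambda>j. 1 / (real (Suc j))\<^sup>2"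
  have w0: "summable ?w" "suminf ?w < Q"
    using \<theta> by (auto simp: sobolev_ellipsoid_def)
  have w: "summable (\<lambda>j. ?w (Suc j))"
    using w0(1) by (subst summable_Suc_iff)
  have w_le: "(\<Sum>j. ?w (Suc j)) \<le> Q"
    using w0(2) p suminf_split_head[OF w0(1)] by (simp add: freq_weight_def[of 0] power_0_left)
  have q: "summable ?q"
    using inverse_power_summable[of 2, where 'a=real]
    by (subst summable_Suc_iff[of "\<lambda>j. 1 / (real j)\<^sup>2"]) (simp add: inverse_eq_divide)
  have wq: "summable (\<lambda>j. (?w (Suc j) + ?q j) / 2)"
    using w q by (intro summable_divide summable_add)
  have le: "\<bar>\<theta> (Suc j)\<bar> \<le> (?w (Suc j) + ?q j) / 2" for j
  proof -
    let ?v = "real (freq_weight (Suc j)) ^ p"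
    have "real (Suc j) ^ 1 \<le> real (Suc j) ^ p"
      using p by (intro power_increasing) auto
    also have "\<dots> \<le> ?v"
      using freq_weight_ge[of "Suc j"] by (intro power_mono) (auto simp del: of_nat_Suc)
    finally have v_ge: "real (Suc j) \<le> ?v" by simp
    have vpos: "?v > 0"
      by (simp add: freq_weight_def)
    have v: "1 / ?v \<le> 1 / real (Suc j)"
      using v_ge by (intro divide_left_mono) (auto simp: freq_weight_def)
    have "2 * \<bar>\<theta> (Suc j)\<bar> = 2 * (?v * \<bar>\<theta> (Suc j)\<bar>) * (1 / ?v)"
      by (simp add: freq_weight_def)
    also have "\<dots> \<le> (?v * \<bar>\<theta> (Suc j)\<bar>)\<^sup>2 + (1 / ?v)\<^sup>2"
      by (rule sum_squares_bound)
    also have "(1 / ?v)\<^sup>2 \<le> (1 / real (Suc j))\<^sup>2"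
      using v vpos by (intro power_mono) auto
    also have "(?v * \<bar>\<theta> (Suc j)\<bar>)\<^sup>2 = ?w (Suc j)"
      by (simp add: power_mult_distrib power_mult[symmetric] mult.commute)
    finally show ?thesis by (simp add: power_divide)
  qed
  show "summable (\<lambda>j. \<bar>\<theta> (Suc j)\<bar>)"
    by (rule summable_comparison_test'[where N=0, OF wq]) (use le in auto)
  then have "(\<Sum>j. \<bar>\<theta> (Suc j)\<bar>) \<le> (\<Sum>j. (?w (Suc j) + ?q j) / 2)"
    using le wq by (intro suminf_le) auto
  also have "\<dots> = ((\<Sum>j. ?w (Suc j)) + inverse_square_sum) / 2"
    using w q by (simp add: suminf_divide suminf_add summable_add inverse_square_sum_def)
  finally show "(\<Sum>j. \<bar>\<theta> (Suc j)\<bar>) \<le> (Q + inverse_square_sum) / 2"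
    using w_le by simp
qed

lemma abs_log_series_ellipsoid_le:
  assumes "p \<ge> 1" "\<theta> \<in> sobolev_ellipsoid p Q"
  shows "\<bar>log_series \<theta> x\<bar> \<le> log_bound Q"
  unfolding log_bound_def
  by (rule order_trans[OF abs_log_series_le[OF sobolev_ellipsoid_abs_summable(1)[OF assms]]
        mult_left_mono[OF sobolev_ellipsoid_abs_summable(2)[OF assms]]]) simp

definition param_dist2 :: "(nat \<Rightarrow> real) \<Rightarrow> (nat \<Rightarrow> real) \<Rightarrow> real" where
  "param_dist2 \<theta> \<eta> = (\<Sum>j. (\<theta> (Suc j) - \<eta> (Suc j))\<^sup>2)"

lemma power2_diff_le: "(a - b)\<^sup>2 \<le> 2 * a\<^sup>2 + 2 * (b::real)\<^sup>2"
  using zero_le_power2[of "a + b"] by (simp add: power2_eq_square algebra_simps)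

lemma summable_power2_diff:
  fixes a b :: "nat \<Rightarrow> real"
  assumes "summable (\<lambda>j. (a j)\<^sup>2)" "summable (\<lambda>j. (b j)\<^sup>2)"
  shows "summable (\<lambda>j. (a j - b j)\<^sup>2)"
  by (rule summable_comparison_test'[where N=0 and g="\<lambda>j. 2 * (a j)\<^sup>2 + 2 * (b j)\<^sup>2"])
    (use assms power2_diff_le in \<open>auto intro!: summable_add summable_mult\<close>)

lemma ellipsoid_tail_le:
  assumes k: "k \<ge> 1" and \<theta>: "\<theta> \<in> sobolev_ellipsoid p Q"
  shows "(\<Sum>j. (\<theta> (j + Suc k))\<^sup>2) \<le> Q / real k ^ (2 * p)"
proof -
  let ?w = "\<lambda>j. real (freq_weight j) ^ (2 * p) * (\<theta> j)\<^sup>2"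
  have w: "summable ?w" "suminf ?w < Q" and sq: "summable (\<lambda>j. (\<theta> j)\<^sup>2)"
    using \<theta> by (auto simp: sobolev_ellipsoid_def)
  have "real k ^ (2 * p) * (\<Sum>j. (\<theta> (j + Suc k))\<^sup>2) = (\<Sum>j. real k ^ (2 * p) * (\<theta> (j + Suc k))\<^sup>2)"
    using summable_ignore_initial_segment[OF sq, of "Suc k"] by (rule suminf_mult[symmetric])
  also have "\<dots> \<le> (\<Sum>j. ?w (j + Suc k))"
  proof (rule suminf_le)
    show "real k ^ (2 * p) * (\<theta> (j + Suc k))\<^sup>2 \<le> ?w (j + Suc k)" for j
      using freq_weight_ge[of "j + Suc k"] by (intro mult_right_mono power_mono) auto
  qed (use summable_ignore_initial_segment[OF sq, of "Suc k"]
       summable_ignore_initial_segment[OF w(1), of "Suc k"] in \<open>auto intro!: summable_mult\<close>)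
  also have "\<dots> \<le> suminf ?w"
    unfolding suminf_minus_initial_segment[OF w(1), of "Suc k"]
    by (simp add: sum_nonneg del: sum.lessThan_Suc)
  finally show ?thesis using w(2) k by (simp add: field_simps)
qed

text \<open>
  The first \<open>k\<close> coordinates are controlled by the box, the remaining ones by the decay that
  membership in the ellipsoid forces.
\<close>

lemma param_dist2_le:
  assumes k: "k \<ge> 1" and \<theta>: "\<theta> \<in> sobolev_ellipsoid p Q" and \<eta>: "\<eta> \<in> sobolev_ellipsoid p Q"
    and close: "\<And>j. j \<in> {1..k} \<Longrightarrow> \<bar>\<theta> j - \<eta> j\<bar> \<le> r"
  shows "param_dist2 \<theta> \<eta> \<le> real k * r\<^sup>2 + 4 * Q / real k ^ (2 * p)"
proof -
  let ?d = "\<lambda>j. (\<theta> j - \<eta> j)\<^sup>2"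
  have t: "summable (\<lambda>j. (\<theta> j)\<^sup>2)" and e: "summable (\<lambda>j. (\<eta> j)\<^sup>2)"
    using \<theta> \<eta> by (auto simp: sobolev_ellipsoid_def)
  note t' = summable_ignore_initial_segment[OF t, of "Suc k"]
  note e' = summable_ignore_initial_segment[OF e, of "Suc k"]
  have d: "summable (\<lambda>j. ?d (Suc j))"
    using summable_power2_diff[OF t e] by (subst summable_Suc_iff)
  have "param_dist2 \<theta> \<eta> = (\<Sum>j. ?d (j + Suc k)) + (\<Sum>j<k. ?d (Suc j))"
    unfolding param_dist2_def using suminf_split_initial_segment[OF d, of k] by simp
  also have "(\<Sum>j<k. ?d (Suc j)) \<le> (\<Sum>j<k. r\<^sup>2)"
  proof (rule sum_mono)
    fix j assume "j \<in> {..<k}"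
    then have "\<bar>\<theta> (Suc j) - \<eta> (Suc j)\<bar> \<le> r" by (intro close) auto
    then show "?d (Suc j) \<le> r\<^sup>2" using power_mono[of "\<bar>\<theta> (Suc j) - \<eta> (Suc j)\<bar>" r 2] by simp
  qed
  also have "(\<Sum>j. ?d (j + Suc k)) \<le> (\<Sum>j. 2 * (\<theta> (j + Suc k))\<^sup>2 + 2 * (\<eta> (j + Suc k))\<^sup>2)"
    by (intro suminf_le power2_diff_le summable_power2_diff t' e' summable_add summable_mult)
  also have "\<dots> = 2 * (\<Sum>j. (\<theta> (j + Suc k))\<^sup>2) + 2 * (\<Sum>j. (\<eta> (j + Suc k))\<^sup>2)"
    using t' e' by (subst suminf_add[symmetric]) (auto simp: suminf_mult intro: summable_mult)
  also have "\<dots> \<le> 4 * Q / real k ^ (2 * p)"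
    using ellipsoid_tail_le[OF k \<theta>] ellipsoid_tail_le[OF k \<eta>] by simp
  finally show ?thesis by simp
qed

section \<open>Exponential densities over the ellipsoid\<close>

lemma integral_exp_log_series_bounds:
  assumes "p \<ge> 1" "\<theta> \<in> sobolev_ellipsoid p Q"
  shows "integrable unit_lborel (\<lambda>t. exp (log_series \<theta> t))"
    and "exp (- log_bound Q) \<le> (\<integral>t. exp (log_series \<theta> t) \<partial>unit_lborel)"
    and "(\<integral>t. exp (log_series \<theta> t) \<partial>unit_lborel) \<le> exp (log_bound Q)"
proof -
  note b = abs_log_series_ellipsoid_le[OF assms]
  show i: "integrable unit_lborel (\<lambda>t. exp (log_series \<theta> t))"
    by (rule unit.integrable_const_bound[where B="exp (log_bound Q)"])
      (use b in \<open>auto simp: abs_le_iff intro!: measurable_unit_lborel_real\<close>)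
  show "exp (- log_bound Q) \<le> (\<integral>t. exp (log_series \<theta> t) \<partial>unit_lborel)"
    using integral_mono[OF _ i, of "\<lambda>_. exp (- log_bound Q)"] b unit.prob_space
    by (simp add: abs_le_iff minus_le_iff)
  show "(\<integral>t. exp (log_series \<theta> t) \<partial>unit_lborel) \<le> exp (log_bound Q)"
    using integral_mono[OF i, of "\<lambda>_. exp (log_bound Q)"] b unit.prob_space
    by (simp add: abs_le_iff)
qed

lemma exp_density_nonneg: "0 \<le> exp_density \<theta> x"
  by (simp add: exp_density_def)

lemma exp_density_bounds:
  assumes "p \<ge> 1" "\<theta> \<in> sobolev_ellipsoid p Q"
  shows "exp (- 2 * log_bound Q) \<le> exp_density \<theta> x"
    and "exp_density \<theta> x \<le> exp (2 * log_bound Q)"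
proof -
  note b = abs_log_series_ellipsoid_le[OF assms, of x]
  note z = integral_exp_log_series_bounds[OF assms]
  have zpos: "0 < (\<integral>t. exp (log_series \<theta> t) \<partial>unit_lborel)"
    using z(2) by (rule less_le_trans[OF exp_gt_zero])
  have "exp (- log_bound Q) / exp (log_bound Q) \<le> exp_density \<theta> x"
    unfolding exp_density_def by (rule frac_le) (use b z zpos in \<open>auto simp: abs_le_iff\<close>)
  then show "exp (- 2 * log_bound Q) \<le> exp_density \<theta> x"
    by (simp add: exp_diff[symmetric])
  have "exp_density \<theta> x \<le> exp (log_bound Q) / exp (- log_bound Q)"
    unfolding exp_density_def by (rule frac_le) (use b z zpos in \<open>auto simp: abs_le_iff\<close>)
  then show "exp_density \<theta> x \<le> exp (2 * log_bound Q)"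
    by (simp add: exp_diff[symmetric])
qed

lemma exp_density_pos:
  assumes "p \<ge> 1" "\<theta> \<in> sobolev_ellipsoid p Q"
  shows "0 < exp_density \<theta> x"
  using exp_density_bounds(1)[OF assms, of x] by (rule less_le_trans[OF exp_gt_zero])

lemma exp_density_measurable [measurable]: "exp_density \<theta> \<in> borel_measurable borel"
  unfolding exp_density_def by measurable

lemma unit_measurable_exp_density [measurable]: "exp_density \<theta> \<in> borel_measurable unit_lborel"
  by (rule measurable_unit_lborel_real) simp

lemma integral_exp_density:
  assumes "p \<ge> 1" "\<theta> \<in> sobolev_ellipsoid p Q"
  shows "integrable unit_lborel (exp_density \<theta>)" "(\<integral>x. exp_density \<theta> x \<partial>unit_lborel) = 1"
proof -
  note z = integral_exp_log_series_bounds[OF assms]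
  show "integrable unit_lborel (exp_density \<theta>)"
    unfolding exp_density_def using z(1) by simp
  have "exp (- log_bound Q) > 0" by simp
  with z(2) have "(\<integral>t. exp (log_series \<theta> t) \<partial>unit_lborel) \<noteq> 0" by linarith
  then show "(\<integral>x. exp_density \<theta> x \<partial>unit_lborel) = 1"
    unfolding exp_density_def by simp
qed

lemma prob_space_exp_model:
  assumes "p \<ge> 1" "\<theta> \<in> sobolev_ellipsoid p Q"
  shows "prob_space (exp_model \<theta>)"
  unfolding exp_model_def
  by (rule prob_spaceI)
    (use integral_exp_density[OF assms] in
      \<open>simp add: emeasure_density nn_integral_eq_integral exp_density_nonneg
         space_unit_lborel[symmetric] del: space_unit_lborel cong: nn_integral_cong\<close>)

lemma integrable_unit_bounded:
  fixes f :: "real \<Rightarrow> real"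
  assumes "f \<in> borel_measurable borel" "\<And>x. \<bar>f x\<bar> \<le> C"
  shows "integrable unit_lborel f"
  by (rule unit.integrable_const_bound[where B=C])
    (use assms in \<open>auto intro: measurable_unit_lborel_real\<close>)

text \<open>
  Jensen's inequality, from \<open>0 \<le> (\<bar>f x\<bar> - m)\<^sup>2\<close> with \<open>m\<close> the mean of \<open>\<bar>f\<bar>\<close>.
\<close>

lemma unit_integral_sq_le:
  fixes f :: "real \<Rightarrow> real"
  assumes "f \<in> borel_measurable borel" "\<And>x. \<bar>f x\<bar> \<le> C"
  shows "(\<integral>x. \<bar>f x\<bar> \<partial>unit_lborel)\<^sup>2 \<le> (\<integral>x. (f x)\<^sup>2 \<partial>unit_lborel)"
proof -
  define m where "m = (\<integral>x. \<bar>f x\<bar> \<partial>unit_lborel)"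
  have sq: "\<bar>(f x)\<^sup>2\<bar> \<le> C\<^sup>2" for x
    using power_mono[OF assms(2)[of x], of 2] by simp
  have i: "integrable unit_lborel (\<lambda>x. \<bar>f x\<bar>)" "integrable unit_lborel (\<lambda>x. (f x)\<^sup>2)"
    using assms sq by (auto intro!: integrable_unit_bounded)
  have "2 * m * m - m\<^sup>2 = (\<integral>x. 2 * m * \<bar>f x\<bar> - m\<^sup>2 \<partial>unit_lborel)"
    using i unit.prob_space by (simp add: m_def)
  also have "\<dots> \<le> (\<integral>x. (f x)\<^sup>2 \<partial>unit_lborel)"
  proof (rule integral_mono)
    show "2 * m * \<bar>f x\<bar> - m\<^sup>2 \<le> (f x)\<^sup>2" for x
      using zero_le_power2[of "\<bar>f x\<bar> - m"] by (simp add: power2_diff algebra_simps)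
  qed (use i in auto)
  finally show ?thesis by (simp add: m_def power2_eq_square)
qed

lemma abs_exp_diff_le:
  assumes "\<bar>u\<bar> \<le> B" "\<bar>v\<bar> \<le> (B::real)"
  shows "\<bar>exp u - exp v\<bar> \<le> exp B * \<bar>u - v\<bar>"
proof -
  have *: "exp y - exp x \<le> exp B * (y - x)" if "x \<le> y" "y \<le> B" for x y :: real
  proof -
    have "exp y - exp x = exp y * (1 - exp (x - y))" by (simp add: algebra_simps exp_diff)
    also have "\<dots> \<le> exp y * (y - x)"
    proof (rule mult_left_mono)
      show "1 - exp (x - y) \<le> y - x" using exp_ge_add_one_self[of "x - y"] by linarith
    qed simp
    also have "\<dots> \<le> exp B * (y - x)" using that by (intro mult_right_mono) auto
    finally show ?thesis .
  qed
  show ?thesis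
  proof (cases "u \<le> v")
    case True
    then have "exp u \<le> exp v" by simp
    then show ?thesis using *[of u v] assms True by simp
  next
    case False
    then have "exp v \<le> exp u" by simp
    then show ?thesis using *[of v u] assms False by simp
  qed
qed

text \<open>
  On the range of the uniformly bounded log-densities the exponential is Lipschitz; this controls
  the unnormalised densities and, after integration, the normalising constants.  Bessel's inequality
  converts the \<open>L\<^sup>2\<close> distance of the log-densities into a distance of parameters.
\<close>

lemma exp_density_L2_le:
  assumes p: "p \<ge> 1" and \<theta>: "\<theta> \<in> sobolev_ellipsoid p Q" and \<eta>: "\<eta> \<in> sobolev_ellipsoid p Q"
  shows "(\<integral>x. (exp_density \<theta> x - exp_density \<eta> x)\<^sup>2 \<partial>unit_lborel)
           \<le> 4 * exp (8 * log_bound Q) * param_dist2 \<theta> \<eta>"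
proof -
  define B where "B = log_bound Q"
  define g where "g = (\<lambda>x. log_series \<theta> x - log_series \<eta> x)"
  define Z where "Z = (\<lambda>\<theta>. \<integral>t. exp (log_series \<theta> t) \<partial>unit_lborel)"
  define m where "m = (\<integral>x. \<bar>g x\<bar> \<partial>unit_lborel)"
  have Z_eq: "Z \<zeta> = (\<integral>t. exp (log_series \<zeta> t) \<partial>unit_lborel)" for \<zeta>
    by (simp add: Z_def)
  note bt = abs_log_series_ellipsoid_le[OF p \<theta>, folded B_def]
  note be = abs_log_series_ellipsoid_le[OF p \<eta>, folded B_def]
  note zt = integral_exp_log_series_bounds[OF p \<theta>, folded B_def, folded Z_eq]
  note ze = integral_exp_log_series_bounds[OF p \<eta>, folded B_def, folded Z_eq]
  have B0: "0 \<le> B" using bt[of 0] by simp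
  have gm [measurable]: "g \<in> borel_measurable borel" unfolding g_def by measurable
  have gb: "\<bar>g x\<bar> \<le> 2 * B" for x using bt[of x] be[of x] by (simp add: g_def)
  have g2b: "\<bar>(g x)\<^sup>2\<bar> \<le> (2 * B)\<^sup>2" for x using power_mono[OF gb[of x], of 2] by simp
  have gi: "integrable unit_lborel (\<lambda>x. \<bar>g x\<bar>)" "integrable unit_lborel (\<lambda>x. (g x)\<^sup>2)"
    using gb g2b by (auto intro!: integrable_unit_bounded)
  have m0: "0 \<le> m" by (simp add: m_def)
  have zdiff: "\<bar>Z \<eta> - Z \<theta>\<bar> \<le> exp B * m"
  proof -
    have "\<bar>Z \<eta> - Z \<theta>\<bar> = \<bar>\<integral>x. exp (log_series \<eta> x) - exp (log_series \<theta> x) \<partial>unit_lborel\<bar>"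
      unfolding Z_eq using zt(1) ze(1) by simp
    also have "\<dots> \<le> (\<integral>x. \<bar>exp (log_series \<eta> x) - exp (log_series \<theta> x)\<bar> \<partial>unit_lborel)"
      by (rule integral_abs_bound)
    also have "\<dots> \<le> (\<integral>x. exp B * \<bar>g x\<bar> \<partial>unit_lborel)"
    proof (rule integral_mono)
      show "\<bar>exp (log_series \<eta> x) - exp (log_series \<theta> x)\<bar> \<le> exp B * \<bar>g x\<bar>" for x
        using abs_exp_diff_le[OF be bt] by (simp add: g_def abs_minus_commute)
    qed (use zt(1) ze(1) gi in auto)
    finally show ?thesis by (simp add: m_def)
  qed
  have Zt0: "0 < Z \<theta>" using zt(2) by (rule less_le_trans[OF exp_gt_zero])
  have Ze0: "0 < Z \<eta>" using ze(2) by (rule less_le_trans[OF exp_gt_zero])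
  have inv: "1 / Z \<theta> \<le> exp B"
    using zt(2) Zt0 by (simp add: exp_minus field_simps)
  have pt: "\<bar>exp_density \<theta> x - exp_density \<eta> x\<bar> \<le> exp (4 * B) * (\<bar>g x\<bar> + m)" for x
  proof -
    have e: "exp_density \<theta> x - exp_density \<eta> x
        = (exp (log_series \<theta> x) - exp (log_series \<eta> x)) * (1 / Z \<theta>)
          + exp_density \<eta> x * ((Z \<eta> - Z \<theta>) * (1 / Z \<theta>))"
      unfolding exp_density_def Z_eq[symmetric] using Zt0 Ze0 by (simp add: field_simps)
    have "\<bar>exp_density \<theta> x - exp_density \<eta> x\<bar>
        \<le> \<bar>exp (log_series \<theta> x) - exp (log_series \<eta> x)\<bar> * (1 / Z \<theta>)
          + exp_density \<eta> x * (\<bar>Z \<eta> - Z \<theta>\<bar> * (1 / Z \<theta>))"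
      unfolding e using Zt0 exp_density_nonneg[of \<eta> x]
      by (intro order_trans[OF abs_triangle_ineq]) (simp add: abs_mult)
    also have "\<dots> \<le> (exp B * \<bar>g x\<bar>) * exp B + exp (2 * B) * ((exp B * m) * exp B)"
      using abs_exp_diff_le[OF bt be, of x] inv zdiff m0 Zt0 exp_density_nonneg[of \<eta> x]
        exp_density_bounds(2)[OF p \<eta>, of x]
      by (intro add_mono mult_mono) (auto simp: g_def B_def)
    also have "\<dots> = exp (2 * B) * \<bar>g x\<bar> + exp (4 * B) * m"
      by (simp add: exp_add[symmetric] mult_ac flip: exp_of_nat_mult)
    also have "\<dots> \<le> exp (4 * B) * \<bar>g x\<bar> + exp (4 * B) * m"
      using B0 m0 by (intro add_mono mult_right_mono) auto
    finally show ?thesis by (simp add: algebra_simps)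
  qed
  have pt2: "(exp_density \<theta> x - exp_density \<eta> x)\<^sup>2 \<le> exp (8 * B) * (2 * (g x)\<^sup>2 + 2 * m\<^sup>2)" for x
  proof -
    have "(exp_density \<theta> x - exp_density \<eta> x)\<^sup>2 \<le> (exp (4 * B) * (\<bar>g x\<bar> + m))\<^sup>2"
      using power_mono[OF pt[of x], of 2] by simp
    also have "\<dots> = exp (8 * B) * (\<bar>g x\<bar> + m)\<^sup>2"
      by (simp add: power_mult_distrib exp_of_nat_mult[symmetric] flip: exp_double)
    also have "(\<bar>g x\<bar> + m)\<^sup>2 \<le> 2 * (g x)\<^sup>2 + 2 * m\<^sup>2"
      using power2_diff_le[of "\<bar>g x\<bar>" "- m"] by simp
    finally show ?thesis by simp
  qed
  have "(\<integral>x. (exp_density \<theta> x - exp_density \<eta> x)\<^sup>2 \<partial>unit_lborel)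
      \<le> (\<integral>x. exp (8 * B) * (2 * (g x)\<^sup>2 + 2 * m\<^sup>2) \<partial>unit_lborel)"
  proof (rule integral_mono[OF _ _ pt2])
    show i: "integrable unit_lborel (\<lambda>x. exp (8 * B) * (2 * (g x)\<^sup>2 + 2 * m\<^sup>2))"
      using gi by simp
    show "integrable unit_lborel (\<lambda>x. (exp_density \<theta> x - exp_density \<eta> x)\<^sup>2)"
      by (rule Bochner_Integration.integrable_bound[OF i]) (use pt2 in auto)
  qed
  also have "\<dots> = exp (8 * B) * (2 * (\<integral>x. (g x)\<^sup>2 \<partial>unit_lborel) + 2 * m\<^sup>2)"
    using gi unit.prob_space by simp
  also have "\<dots> \<le> exp (8 * B) * (4 * (\<integral>x. (g x)\<^sup>2 \<partial>unit_lborel))"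
    using unit_integral_sq_le[OF gm gb] by (intro mult_left_mono) (auto simp: m_def)
  also have "(\<integral>x. (g x)\<^sup>2 \<partial>unit_lborel) \<le> param_dist2 \<theta> \<eta>"
  proof -
    have at: "summable (\<lambda>j. \<bar>\<theta> (Suc j)\<bar>)" and ae: "summable (\<lambda>j. \<bar>\<eta> (Suc j)\<bar>)"
      using sobolev_ellipsoid_abs_summable(1)[OF p] \<theta> \<eta> by auto
    have st: "summable (\<lambda>j. (\<theta> j)\<^sup>2)" and se: "summable (\<lambda>j. (\<eta> j)\<^sup>2)"
      using \<theta> \<eta> by (auto simp: sobolev_ellipsoid_def)
    have "summable (\<lambda>j. \<bar>\<theta> (Suc j) - \<eta> (Suc j)\<bar>)"
      by (rule summable_comparison_test'[where N=0, OF summable_add[OF at ae]]) auto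
    moreover have "summable (\<lambda>j. (\<theta> (Suc j) - \<eta> (Suc j))\<^sup>2)"
      using summable_power2_diff[OF st se] by (subst summable_Suc_iff)
    ultimately show ?thesis
      unfolding g_def log_series_diff[OF at ae] param_dist2_def by (intro bessel_log_series)
  qed
  finally show ?thesis by (simp add: B_def)
qed

section \<open>Hellinger affinity and moments of likelihood ratios\<close>

lemma measurable_log_series_pair [measurable (raw)]:
  assumes [measurable]: "f \<in> measurable M (PiM UNIV (\<lambda>_. borel))" "g \<in> borel_measurable M"
  shows "(\<lambda>z. log_series (f z) (g z)) \<in> borel_measurable M"
  unfolding log_series_def trig_basis_def by measurable

lemma exp_density_joint_measurable:
  "(\<lambda>(\<theta>, x). exp_density \<theta> x) \<in> borel_measurable (PiM UNIV (\<lambda>_. borel) \<Otimes>\<^sub>M unit_lborel)"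
proof -
  let ?\<Theta> = "PiM UNIV (\<lambda>_. borel) :: (nat \<Rightarrow> real) measure"
  have [measurable]: "(\<lambda>z. z) \<in> measurable unit_lborel borel"
    by (rule measurable_unit_lborel_real) simp
  have "(\<lambda>z. exp (log_series (fst z) (snd z))) \<in> borel_measurable (?\<Theta> \<Otimes>\<^sub>M unit_lborel)"
    by measurable
  then have [measurable]: "(\<lambda>\<theta>. \<integral>t. exp (log_series \<theta> t) \<partial>unit_lborel) \<in> borel_measurable ?\<Theta>"
    by (intro unit.borel_measurable_lebesgue_integral) (simp add: case_prod_beta)
  have "(\<lambda>z. exp_density (fst z) (snd z)) \<in> borel_measurable (?\<Theta> \<Otimes>\<^sub>M unit_lborel)"
    unfolding exp_density_def by measurable
  then show ?thesis by (simp add: case_prod_beta)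
qed

lemma sets_exp_model [simp, measurable_cong]: "sets (exp_model \<theta>) = sets unit_lborel"
  by (simp add: exp_model_def)

lemma nn_integral_exp_model:
  assumes [measurable]: "g \<in> borel_measurable borel" and g: "\<And>x. 0 \<le> g x"
  shows "(\<integral>\<^sup>+x. ennreal (g x) \<partial>exp_model \<theta>) = (\<integral>\<^sup>+x. ennreal (exp_density \<theta> x * g x) \<partial>unit_lborel)"
proof -
  have "g \<in> borel_measurable unit_lborel" by (rule measurable_unit_lborel_real) simp
  then show ?thesis
    unfolding exp_model_def
    by (subst nn_integral_density) (auto simp: ennreal_mult g exp_density_nonneg)
qed

locale ellipsoid_pair =
  fixes p :: nat and Q :: real and \<theta> \<eta> :: "nat \<Rightarrow> real"
  assumes p: "p \<ge> 1" and \<theta>: "\<theta> \<in> sobolev_ellipsoid p Q" and \<eta>: "\<eta> \<in> sobolev_ellipsoid p Q"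
begin

abbreviation "f \<equiv> exp_density \<theta>"
abbreviation "g \<equiv> exp_density \<eta>"

lemma integrable_diff_sq: "integrable unit_lborel (\<lambda>x. (f x - g x)\<^sup>2)"
proof (rule integrable_unit_bounded)
  fix x
  have "\<bar>f x - g x\<bar> \<le> exp (2 * log_bound Q)"
    using exp_density_bounds(2)[OF p \<theta>, of x] exp_density_bounds(2)[OF p \<eta>, of x]
      exp_density_nonneg[of \<theta> x] exp_density_nonneg[of \<eta> x] by (simp add: abs_le_iff)
  then show "\<bar>(f x - g x)\<^sup>2\<bar> \<le> (exp (2 * log_bound Q))\<^sup>2"
    using power_mono[of "\<bar>f x - g x\<bar>" _ 2] by simp
qed measurable

lemma integrable_sqrt_diff_sq: "integrable unit_lborel (\<lambda>x. (sqrt (f x) - sqrt (g x))\<^sup>2)"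
proof (rule Bochner_Integration.integrable_bound)
  show "integrable unit_lborel (\<lambda>x. 2 * f x + 2 * g x)"
    using integral_exp_density(1)[OF p \<theta>] integral_exp_density(1)[OF p \<eta>] by simp
  show "AE x in unit_lborel. norm ((sqrt (f x) - sqrt (g x))\<^sup>2) \<le> norm (2 * f x + 2 * g x)"
    using power2_diff_le[of "sqrt (f _)" "sqrt (g _)"] by (auto simp: exp_density_nonneg)
qed measurable

lemma hellinger_sq:
  "(hellinger f g)\<^sup>2 = (\<integral>x. (sqrt (f x) - sqrt (g x))\<^sup>2 \<partial>unit_lborel)"
  by (simp add: hellinger_def)

text \<open>
  The affinity equals \<open>1 - h\<^sup>2 / 2\<close>; written as an exponential it can be raised to the power of the
  sample size.
\<close>

lemma hellinger_affinity_le: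
  "(\<integral>\<^sup>+x. ennreal (sqrt (g x / f x)) \<partial>exp_model \<theta>) \<le> ennreal (exp (- (hellinger f g)\<^sup>2 / 2))"
proof -
  have eq: "f x * sqrt (g x / f x) = (f x + g x - (sqrt (f x) - sqrt (g x))\<^sup>2) / 2" for x
  proof -
    have "f x * sqrt (g x / f x) = sqrt (f x) * sqrt (f x) * (sqrt (g x) / sqrt (f x))"
      by (simp add: real_sqrt_divide exp_density_nonneg)
    also have "\<dots> = sqrt (f x) * sqrt (g x)"
    proof -
      have "u * u * (v / u) = u * v" if "u \<noteq> 0" for u v :: real using that by simp
      moreover have "sqrt (f x) \<noteq> 0" using exp_density_pos[OF p \<theta>, of x] by simp
      ultimately show ?thesis by blast
    qed
    finally show ?thesis by (simp add: power2_diff exp_density_nonneg)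
  qed
  have i: "integrable unit_lborel (\<lambda>x. f x * sqrt (g x / f x))"
    unfolding eq using integral_exp_density(1)[OF p \<theta>] integral_exp_density(1)[OF p \<eta>]
      integrable_sqrt_diff_sq by simp
  have "(\<integral>\<^sup>+x. ennreal (sqrt (g x / f x)) \<partial>exp_model \<theta>)
      = (\<integral>\<^sup>+x. ennreal (f x * sqrt (g x / f x)) \<partial>unit_lborel)"
    by (rule nn_integral_exp_model) (auto simp: exp_density_nonneg)
  also have "\<dots> = ennreal (\<integral>x. f x * sqrt (g x / f x) \<partial>unit_lborel)"
    using i by (intro nn_integral_eq_integral) (auto simp: exp_density_nonneg)
  also have "(\<integral>x. f x * sqrt (g x / f x) \<partial>unit_lborel) = 1 - (hellinger f g)\<^sup>2 / 2"
    unfolding eq hellinger_sq using integral_exp_density[OF p \<theta>] integral_exp_density[OF p \<eta>]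
      integrable_sqrt_diff_sq by (simp add: diff_divide_distrib)
  also have "\<dots> \<le> exp (- (hellinger f g)\<^sup>2 / 2)"
    using exp_ge_add_one_self[of "- (hellinger f g)\<^sup>2 / 2"] by simp
  finally show ?thesis by (simp add: ennreal_leI)
qed

lemma L2_le_hellinger:
  "(\<integral>x. (f x - g x)\<^sup>2 \<partial>unit_lborel) \<le> 4 * exp (2 * log_bound Q) * (hellinger f g)\<^sup>2"
proof -
  let ?E = "exp (2 * log_bound Q)"
  have "(\<integral>x. (f x - g x)\<^sup>2 \<partial>unit_lborel)
      \<le> (\<integral>x. 4 * ?E * (sqrt (f x) - sqrt (g x))\<^sup>2 \<partial>unit_lborel)"
  proof (rule integral_mono[OF integrable_diff_sq])
    fix x
    have b: "f x \<le> ?E" "g x \<le> ?E"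
      using exp_density_bounds(2)[OF p \<theta>] exp_density_bounds(2)[OF p \<eta>] by auto
    have "f x - g x = (sqrt (f x) + sqrt (g x)) * (sqrt (f x) - sqrt (g x))"
      by (simp add: algebra_simps exp_density_nonneg)
    then have "(f x - g x)\<^sup>2 = (sqrt (f x) + sqrt (g x))\<^sup>2 * (sqrt (f x) - sqrt (g x))\<^sup>2"
      by (simp add: power_mult_distrib)
    also have "(sqrt (f x) + sqrt (g x))\<^sup>2 \<le> 4 * ?E"
      using power2_diff_le[of "sqrt (f x)" "- sqrt (g x)"] b by (simp add: exp_density_nonneg)
    finally show "(f x - g x)\<^sup>2 \<le> 4 * ?E * (sqrt (f x) - sqrt (g x))\<^sup>2"
      by (simp add: mult_right_mono)
  qed (use integrable_sqrt_diff_sq in simp)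
  then show ?thesis by (simp add: hellinger_sq)
qed

end

text \<open>
  Since \<open>a * b / c = a + b - c + (a - c) * (b - c) / c\<close> and all three densities integrate to one, the
  integral exceeds one only by a product of differences.  The weight \<open>l\<close> in the inequality between
  the arithmetic and geometric means lets the two differences be of different orders.
\<close>

lemma likelihood_ratio_product_le:
  assumes p: "p \<ge> 1" and a: "a \<in> sobolev_ellipsoid p Q" and b: "b \<in> sobolev_ellipsoid p Q"
    and c: "c \<in> sobolev_ellipsoid p Q" and l: "0 < l"
  shows "(\<integral>\<^sup>+x. ennreal (exp_density a x * (exp_density b x / exp_density c x)) \<partial>unit_lborel)
    \<le> ennreal (exp (exp (2 * log_bound Q) / 2 *
        (l * (\<integral>x. (exp_density a x - exp_density c x)\<^sup>2 \<partial>unit_lborel)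
          + (\<integral>x. (exp_density b x - exp_density c x)\<^sup>2 \<partial>unit_lborel) / l)))"
proof -
  interpret ac: ellipsoid_pair p Q a c by unfold_locales fact+
  interpret bc: ellipsoid_pair p Q b c by unfold_locales fact+
  let ?a = "exp_density a" and ?b = "exp_density b" and ?c = "exp_density c"
  let ?E = "exp (2 * log_bound Q)"
  let ?R = "\<lambda>x. ?a x + ?b x - ?c x + ?E / 2 * (l * (?a x - ?c x)\<^sup>2 + (?b x - ?c x)\<^sup>2 / l)"
  let ?K = "?E / 2 * (l * (\<integral>x. (?a x - ?c x)\<^sup>2 \<partial>unit_lborel) + (\<integral>x. (?b x - ?c x)\<^sup>2 \<partial>unit_lborel) / l)"
  note d = integral_exp_density[OF p a] integral_exp_density[OF p b] integral_exp_density[OF p c]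
  have pt: "?a x * (?b x / ?c x) \<le> ?R x" for x
  proof -
    let ?u = "?a x - ?c x" and ?v = "?b x - ?c x"
    have c0: "0 < ?c x" by (rule exp_density_pos[OF p c])
    have inv: "1 / ?c x \<le> ?E"
      using exp_density_bounds(1)[OF p c, of x] c0 by (simp add: exp_minus field_simps)
    have "2 * (sqrt l * \<bar>?u\<bar>) * (\<bar>?v\<bar> / sqrt l) \<le> (sqrt l * \<bar>?u\<bar>)\<^sup>2 + (\<bar>?v\<bar> / sqrt l)\<^sup>2"
      by (rule sum_squares_bound)
    then have uv: "\<bar>?u * ?v\<bar> \<le> (l * ?u\<^sup>2 + ?v\<^sup>2 / l) / 2"
      using l by (simp add: power_mult_distrib power_divide abs_mult)
    have "?a x * (?b x / ?c x) = ?a x + ?b x - ?c x + (?u * ?v) * (1 / ?c x)"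
      using c0 by (simp add: field_simps)
    also have "(?u * ?v) * (1 / ?c x) \<le> \<bar>?u * ?v\<bar> * ?E"
      using inv c0 by (intro mult_mono) auto
    also have "\<dots> \<le> (l * ?u\<^sup>2 + ?v\<^sup>2 / l) / 2 * ?E"
      using uv by (intro mult_right_mono) auto
    finally show ?thesis by (simp add: mult.commute)
  qed
  have i: "integrable unit_lborel ?R"
    using d ac.integrable_diff_sq bc.integrable_diff_sq by simp
  have nn: "0 \<le> ?a x * (?b x / ?c x)" for x by (simp add: exp_density_nonneg)
  have "(\<integral>\<^sup>+x. ennreal (?a x * (?b x / ?c x)) \<partial>unit_lborel) \<le> (\<integral>\<^sup>+x. ennreal (?R x) \<partial>unit_lborel)"
    by (intro nn_integral_mono ennreal_leI pt)
  also have "\<dots> = ennreal (\<integral>x. ?R x \<partial>unit_lborel)"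
    using order_trans[OF nn pt] by (intro nn_integral_eq_integral i AE_I2)
  also have "(\<integral>x. ?R x \<partial>unit_lborel) = 1 + ?K"
    using d ac.integrable_diff_sq bc.integrable_diff_sq by simp
  also have "1 + ?K \<le> exp ?K" by (rule exp_ge_add_one_self)
  finally show ?thesis by (simp add: ennreal_leI)
qed

text \<open>
  This is the chi-square distance plus one, the case \<open>a = b\<close> and \<open>l = 1\<close> of the previous bound.
\<close>

lemma chi_square_le:
  assumes p: "p \<ge> 1" and \<theta>: "\<theta> \<in> sobolev_ellipsoid p Q" and \<eta>: "\<eta> \<in> sobolev_ellipsoid p Q"
  shows "(\<integral>\<^sup>+x. ennreal (1 / (exp_density \<eta> x / exp_density \<theta> x)) \<partial>exp_model \<theta>)
    \<le> ennreal (exp (4 * exp (10 * log_bound Q) * param_dist2 \<theta> \<eta>))"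
proof -
  have "(\<integral>\<^sup>+x. ennreal (1 / (exp_density \<eta> x / exp_density \<theta> x)) \<partial>exp_model \<theta>)
      = (\<integral>\<^sup>+x. ennreal (exp_density \<theta> x * (1 / (exp_density \<eta> x / exp_density \<theta> x))) \<partial>unit_lborel)"
    by (rule nn_integral_exp_model) (auto simp: exp_density_nonneg)
  also have "\<dots> = (\<integral>\<^sup>+x. ennreal (exp_density \<theta> x * (exp_density \<theta> x / exp_density \<eta> x)) \<partial>unit_lborel)"
    by simp
  also have "\<dots> \<le> ennreal (exp (exp (2 * log_bound Q) * (\<integral>x. (exp_density \<theta> x - exp_density \<eta> x)\<^sup>2 \<partial>unit_lborel)))"
    using likelihood_ratio_product_le[OF p \<theta> \<theta> \<eta>, of 1] by simp
  also have "\<dots> \<le> ennreal (exp (exp (2 * log_bound Q) * (4 * exp (8 * log_bound Q) * param_dist2 \<theta> \<eta>)))"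
    by (intro ennreal_leI) (simp add: exp_density_L2_le[OF p \<theta> \<eta>] flip: mult.assoc)
  also have "exp (2 * log_bound Q) * (4 * exp (8 * log_bound Q) * param_dist2 \<theta> \<eta>)
      = 4 * exp (2 * log_bound Q + 8 * log_bound Q) * param_dist2 \<theta> \<eta>"
    unfolding exp_add by (simp only: mult_ac)
  also have "2 * log_bound Q + 8 * log_bound Q = 10 * log_bound Q" by simp
  finally show ?thesis .
qed

text \<open>
  The weight \<open>l = exp (- 4 * log_bound Q) / 16\<close> bounds by \<open>h\<^sup>2 / 8\<close> the contribution of the
  distance between \<open>\<theta>\<close> and \<open>\<eta>\<close>, whatever that distance is; the hypothesis on \<open>\<zeta>\<close> and \<open>\<eta>\<close> bounds
  the other contribution by the same amount.
\<close>

lemma cell_likelihood_ratio_le: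
  assumes p: "p \<ge> 1" and \<theta>: "\<theta> \<in> sobolev_ellipsoid p Q" and \<zeta>: "\<zeta> \<in> sobolev_ellipsoid p Q"
    and \<eta>: "\<eta> \<in> sobolev_ellipsoid p Q"
    and far: "256 * exp (14 * log_bound Q) * param_dist2 \<zeta> \<eta> \<le> (hellinger (exp_density \<theta>) (exp_density \<eta>))\<^sup>2"
  shows "(\<integral>\<^sup>+x. ennreal ((exp_density \<zeta> x / exp_density \<theta> x) / (exp_density \<eta> x / exp_density \<theta> x)) \<partial>exp_model \<theta>)
    \<le> ennreal (exp ((hellinger (exp_density \<theta>) (exp_density \<eta>))\<^sup>2 / 4))"
proof -
  interpret ellipsoid_pair p Q \<theta> \<eta> by unfold_locales fact+
  let ?B = "log_bound Q" and ?h = "hellinger (exp_density \<theta>) (exp_density \<eta>)"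
  have "(\<integral>\<^sup>+x. ennreal ((exp_density \<zeta> x / exp_density \<theta> x) / (exp_density \<eta> x / exp_density \<theta> x)) \<partial>exp_model \<theta>)
      = (\<integral>\<^sup>+x. ennreal (exp_density \<theta> x * ((exp_density \<zeta> x / exp_density \<theta> x) / (exp_density \<eta> x / exp_density \<theta> x))) \<partial>unit_lborel)"
    by (rule nn_integral_exp_model) (auto simp: exp_density_nonneg)
  also have "\<dots> = (\<integral>\<^sup>+x. ennreal (exp_density \<theta> x * (exp_density \<zeta> x / exp_density \<eta> x)) \<partial>unit_lborel)"
    using less_imp_neq[OF exp_density_pos[OF p \<theta>]] by (intro nn_integral_cong) simp
  also have "\<dots> \<le> ennreal (exp (exp (2 * ?B) / 2 *
        (exp (- 4 * ?B) / 16 * (\<integral>x. (exp_density \<theta> x - exp_density \<eta> x)\<^sup>2 \<partial>unit_lborel)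
          + (\<integral>x. (exp_density \<zeta> x - exp_density \<eta> x)\<^sup>2 \<partial>unit_lborel) / (exp (- 4 * ?B) / 16))))"
    by (rule likelihood_ratio_product_le[OF p \<theta> \<zeta> \<eta>]) simp
  also have "\<dots> \<le> ennreal (exp (exp (2 * ?B) / 2 *
        (exp (- 4 * ?B) / 16 * (4 * exp (2 * ?B) * ?h\<^sup>2)
          + (4 * exp (8 * ?B) * param_dist2 \<zeta> \<eta>) / (exp (- 4 * ?B) / 16))))"
    using L2_le_hellinger exp_density_L2_le[OF p \<zeta> \<eta>]
    by (intro ennreal_leI iffD2[OF exp_le_cancel_iff] mult_left_mono add_mono divide_right_mono) auto
  also have "exp (2 * ?B) / 2 *
        (exp (- 4 * ?B) / 16 * (4 * exp (2 * ?B) * ?h\<^sup>2)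
          + (4 * exp (8 * ?B) * param_dist2 \<zeta> \<eta>) / (exp (- 4 * ?B) / 16))
      = ?h\<^sup>2 / 8 + 32 * exp (14 * ?B) * param_dist2 \<zeta> \<eta>"
  proof -
    have e: "exp (real n * ?B) = exp ?B ^ n" for n by (simp add: exp_of_nat_mult)
    show ?thesis
      using e[of 2] e[of 4] e[of 8] e[of 14] by (simp add: exp_minus field_simps)
  qed
  also have "\<dots> \<le> ?h\<^sup>2 / 4" using far by simp
  finally show ?thesis by (simp add: ennreal_leI)
qed

section \<open>Tail bounds for mixtures of product likelihoods\<close>

lemma nn_integral_iid_prod:
  assumes M: "prob_space M" and g [measurable]: "g \<in> borel_measurable M"
  shows "(\<integral>\<^sup>+X. (\<Prod>i<n. g (X i)) \<partial>PiM (UNIV :: nat set) (\<lambda>_. M)) = (\<integral>\<^sup>+x. g x \<partial>M) ^ n"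
proof -
  interpret M: prob_space M by fact
  interpret product_prob_space "\<lambda>_::nat. M" UNIV by standard
  have "(\<integral>\<^sup>+x. g x \<partial>M) ^ n = (\<Prod>i<n. (\<integral>\<^sup>+x. g x \<partial>M))" by simp
  also have "\<dots> = (\<integral>\<^sup>+X. (\<Prod>i<n. g (X i)) \<partial>PiM {..<n} (\<lambda>_. M))"
    by (rule product_nn_integral_prod[symmetric]) auto
  also have "\<dots> = (\<integral>\<^sup>+X. (\<Prod>i<n. g (X i))
      \<partial>distr (PiM UNIV (\<lambda>_. M)) (PiM {..<n} (\<lambda>_. M)) (\<lambda>X. restrict X {..<n}))"
    by (subst distr_PiM_restrict_finite) auto
  also have "\<dots> = (\<integral>\<^sup>+X. (\<Prod>i<n. g (restrict X {..<n} i)) \<partial>PiM UNIV (\<lambda>_. M))"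
    by (rule nn_integral_distr) measurable
  also have "\<dots> = (\<integral>\<^sup>+X. (\<Prod>i<n. g (X i)) \<partial>PiM UNIV (\<lambda>_. M))"
    by (intro nn_integral_cong prod.cong) auto
  finally show ?thesis ..
qed

text \<open>
  Tonelli's theorem: mixing over \<open>\<theta>\<close> commutes with integrating over the sample, and for a fixed
  \<open>\<theta>\<close> the likelihood factorises.
\<close>

lemma nn_integral_mixture_iid_prod:
  fixes g :: "'b \<Rightarrow> 'a \<Rightarrow> ennreal"
  assumes M: "prob_space M" and N: "finite_measure N"
    and g [measurable]: "(\<lambda>(\<theta>, x). g \<theta> x) \<in> borel_measurable (N \<Otimes>\<^sub>M M)"
    and A [measurable]: "A \<in> sets N"
  shows "(\<lambda>X. \<integral>\<^sup>+\<theta>. (\<Prod>i<n. g \<theta> (X i)) * indicator A \<theta> \<partial>N)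
           \<in> borel_measurable (PiM (UNIV :: nat set) (\<lambda>_. M))" (is ?meas)
    and "(\<integral>\<^sup>+X. (\<integral>\<^sup>+\<theta>. (\<Prod>i<n. g \<theta> (X i)) * indicator A \<theta> \<partial>N) \<partial>PiM (UNIV :: nat set) (\<lambda>_. M))
           = (\<integral>\<^sup>+\<theta>. (\<integral>\<^sup>+x. g \<theta> x \<partial>M) ^ n * indicator A \<theta> \<partial>N)" (is ?eq)
proof -
  let ?P = "PiM (UNIV :: nat set) (\<lambda>_. M)"
  interpret M: prob_space M by fact
  interpret N: finite_measure N by fact
  interpret P: prob_space ?P by (intro prob_space_PiM M)
  interpret pair_sigma_finite N ?P ..
  have m [measurable]: "(\<lambda>(\<theta>, X). (\<Prod>i<n. g \<theta> (X i)) * indicator A \<theta>) \<in> borel_measurable (N \<Otimes>\<^sub>M ?P)"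
    by measurable
  show ?meas by measurable
  have "(\<integral>\<^sup>+X. (\<integral>\<^sup>+\<theta>. (\<Prod>i<n. g \<theta> (X i)) * indicator A \<theta> \<partial>N) \<partial>?P)
      = (\<integral>\<^sup>+\<theta>. (\<integral>\<^sup>+X. (\<Prod>i<n. g \<theta> (X i)) * indicator A \<theta> \<partial>?P) \<partial>N)"
    using Fubini'[OF m] by simp
  also have "\<dots> = (\<integral>\<^sup>+\<theta>. (\<integral>\<^sup>+x. g \<theta> x \<partial>M) ^ n * indicator A \<theta> \<partial>N)"
  proof (rule nn_integral_cong)
    fix \<theta> assume [measurable]: "\<theta> \<in> space N"
    have gt [measurable]: "g \<theta> \<in> borel_measurable M" by measurable
    show "(\<integral>\<^sup>+X. (\<Prod>i<n. g \<theta> (X i)) * indicator A \<theta> \<partial>?P) = (\<integral>\<^sup>+x. g \<theta> x \<partial>M) ^ n * indicator A \<theta>"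
      by (subst nn_integral_multc) (auto simp: nn_integral_iid_prod[OF M gt])
  qed
  finally show ?eq .
qed

lemma markov_nn_integral:
  assumes [measurable]: "f \<in> borel_measurable M" and c: "c > 0"
  shows "emeasure M {x \<in> space M. ennreal c \<le> f x} \<le> ennreal (1 / c) * (\<integral>\<^sup>+x. f x \<partial>M)"
proof -
  have "ennreal c \<le> y \<longleftrightarrow> 1 \<le> ennreal (1 / c) * y" for y
    using c by (cases y rule: ennreal_cases)
      (auto simp: ennreal_mult[symmetric] ennreal_mult_top field_simps simp flip: ennreal_1)
  then have "emeasure M {x \<in> space M. ennreal c \<le> f x}
      = emeasure M {x \<in> space M. 1 \<le> ennreal (1 / c) * f x}" by simp
  also have "\<dots> \<le> ennreal (1 / c) * (\<integral>\<^sup>+x. f x * indicator (space M) x \<partial>M)"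
    by (rule nn_integral_Markov_inequality) auto
  also have "(\<integral>\<^sup>+x. f x * indicator (space M) x \<partial>M) = (\<integral>\<^sup>+x. f x \<partial>M)"
    by (intro nn_integral_cong) auto
  finally show ?thesis .
qed

lemma sqrt_prod: "sqrt (prod f A) = (\<Prod>x\<in>A. sqrt (f x))"
  by (induction A rule: infinite_finite_induct) (auto simp: real_sqrt_mult)

text \<open>
  Let \<open>S\<close> be the product of the values of \<open>s\<close> along the sample.  If the mixture reaches \<open>t\<close>, then
  either \<open>S \<ge> u\<close> or the mixture divided by \<open>S\<close> reaches \<open>t / u\<close>.  The first event is controlled
  through \<open>sqrt S\<close>, the second through the expectation, each by Markov's inequality.
\<close>

lemma mixture_likelihood_upper_tail:
  fixes r :: "'b \<Rightarrow> 'a \<Rightarrow> real" and s :: "'a \<Rightarrow> real"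
  assumes M: "prob_space M" and N: "finite_measure N"
    and r [measurable]: "(\<lambda>(\<theta>, x). r \<theta> x) \<in> borel_measurable (N \<Otimes>\<^sub>M M)"
    and s [measurable]: "s \<in> borel_measurable M" and A [measurable]: "A \<in> sets N"
    and s_pos: "\<And>x. 0 < s x" and r_nonneg: "\<And>\<theta> x. 0 \<le> r \<theta> x" and u: "0 < u" and t: "0 < t"
  shows "emeasure (PiM (UNIV :: nat set) (\<lambda>_. M)) {X \<in> space (PiM (UNIV :: nat set) (\<lambda>_. M)).
           ennreal t \<le> (\<integral>\<^sup>+\<theta>. (\<Prod>i<n. ennreal (r \<theta> (X i))) * indicator A \<theta> \<partial>N)}
         \<le> ennreal (1 / sqrt u) * (\<integral>\<^sup>+x. ennreal (sqrt (s x)) \<partial>M) ^ n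
           + ennreal (u / t) * (\<integral>\<^sup>+\<theta>. (\<integral>\<^sup>+x. ennreal (r \<theta> x / s x) \<partial>M) ^ n * indicator A \<theta> \<partial>N)"
proof -
  let ?P = "PiM (UNIV :: nat set) (\<lambda>_. M)"
  interpret N: finite_measure N by fact
  let ?G = "\<lambda>X. \<integral>\<^sup>+\<theta>. (\<Prod>i<n. ennreal (r \<theta> (X i))) * indicator A \<theta> \<partial>N"
  let ?H = "\<lambda>X. \<integral>\<^sup>+\<theta>. (\<Prod>i<n. ennreal (r \<theta> (X i) / s (X i))) * indicator A \<theta> \<partial>N"
  let ?S = "\<lambda>X. \<Prod>i<n. ennreal (sqrt (s (X i)))"
  have H: "?H \<in> borel_measurable ?P"
    "(\<integral>\<^sup>+X. ?H X \<partial>?P) = (\<integral>\<^sup>+\<theta>. (\<integral>\<^sup>+x. ennreal (r \<theta> x / s x) \<partial>M) ^ n * indicator A \<theta> \<partial>N)"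
    using nn_integral_mixture_iid_prod[OF M N _ A, of "\<lambda>\<theta> x. ennreal (r \<theta> x / s x)"] by auto
  have G: "?G \<in> borel_measurable ?P"
    using nn_integral_mixture_iid_prod[OF M N _ A, of "\<lambda>\<theta> x. ennreal (r \<theta> x)"] by auto
  have S: "?S \<in> borel_measurable ?P" "(\<integral>\<^sup>+X. ?S X \<partial>?P) = (\<integral>\<^sup>+x. ennreal (sqrt (s x)) \<partial>M) ^ n"
    by (simp, intro nn_integral_iid_prod M) simp
  have split: "ennreal (sqrt u) \<le> ?S X \<or> ennreal (t / u) \<le> ?H X"
    if X: "X \<in> space ?P" and G_ge: "ennreal t \<le> ?G X" for X
  proof (rule disjCI)
    assume H_lt: "\<not> ennreal (t / u) \<le> ?H X"
    have Xi: "X i \<in> space M" for i using X by (auto simp: space_PiM)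
    let ?s = "\<Prod>i<n. s (X i)"
    have s0: "0 < ?s" using s_pos by (intro prod_pos) auto
    have prod_eq: "(\<Prod>i<n. ennreal (r \<theta> (X i))) = ennreal ?s * (\<Prod>i<n. ennreal (r \<theta> (X i) / s (X i)))" for \<theta>
      using s_pos r_nonneg s0 less_imp_neq[OF s_pos]
      by (subst (1 2) prod_ennreal)
        (auto simp: less_imp_le ennreal_mult[symmetric] prod_nonneg prod_dividef)
    have "?G X = ennreal ?s * ?H X"
      unfolding prod_eq mult.assoc using Xi by (intro nn_integral_cmult) measurable
    moreover obtain h where h: "?H X = ennreal h" "0 \<le> h"
      using H_lt by (cases "?H X" rule: ennreal_cases) auto
    ultimately have "ennreal t \<le> ennreal (?s * h)"
      using G_ge s0 by (simp add: ennreal_mult)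
    then have "t \<le> ?s * h" using s0 h t by (subst (asm) ennreal_le_iff) auto
    also have "\<dots> \<le> ?s * (t / u)"
      using H_lt h s0 t u by (intro mult_left_mono) (auto simp: ennreal_less_iff not_le)
    finally have "u \<le> ?s" using t u by (simp add: field_simps)
    then have "sqrt u \<le> (\<Prod>i<n. sqrt (s (X i)))"
      by (metis real_sqrt_le_mono sqrt_prod)
    then show "ennreal (sqrt u) \<le> ?S X"
      using s_pos by (subst prod_ennreal) (auto simp: less_imp_le intro!: ennreal_leI)
  qed
  have "emeasure ?P {X \<in> space ?P. ennreal t \<le> ?G X}
      \<le> emeasure ?P ({X \<in> space ?P. ennreal (sqrt u) \<le> ?S X} \<union> {X \<in> space ?P. ennreal (t / u) \<le> ?H X})"
    using split S(1) H(1) by (intro emeasure_mono) auto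
  also have "\<dots> \<le> emeasure ?P {X \<in> space ?P. ennreal (sqrt u) \<le> ?S X}
      + emeasure ?P {X \<in> space ?P. ennreal (t / u) \<le> ?H X}"
    using S(1) H(1) by (intro emeasure_subadditive) auto
  also have "\<dots> \<le> ennreal (1 / sqrt u) * (\<integral>\<^sup>+X. ?S X \<partial>?P) + ennreal (1 / (t / u)) * (\<integral>\<^sup>+X. ?H X \<partial>?P)"
    using u t by (intro add_mono markov_nn_integral S H) auto
  finally show ?thesis by (simp add: S H)
qed

lemma two_mult_le_add_inverse:
  fixes t L :: real
  assumes "0 < L"
  shows "2 * t \<le> L + t\<^sup>2 * (1 / L)"
proof -
  have "0 \<le> (L - t)\<^sup>2 / L" using assms by simp
  also have "\<dots> = L + t\<^sup>2 * (1 / L) - 2 * t"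
    using assms by (simp add: power2_eq_square field_simps)
  finally show ?thesis by simp
qed

text \<open>
  Integrating \<open>2 * t \<le> L + t\<^sup>2 / L\<close> over \<open>B\<close>, with \<open>L\<close> the likelihood ratio, shows that a mixture
  below \<open>t\<close> times the mass of \<open>B\<close> forces the integral of \<open>1 / L\<close> to exceed the mass of \<open>B\<close> divided by
  \<open>t\<close>, an event to which Markov's inequality applies.  Unlike a variance bound this gives an
  exponentially small probability.
\<close>

lemma mixture_likelihood_lower_tail:
  fixes r :: "'b \<Rightarrow> 'a \<Rightarrow> real"
  assumes M: "prob_space M" and N: "finite_measure N"
    and r [measurable]: "(\<lambda>(\<theta>, x). r \<theta> x) \<in> borel_measurable (N \<Otimes>\<^sub>M M)"
    and B [measurable]: "B \<in> sets N" and b: "0 < measure N B"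
    and r_pos: "\<And>\<theta> x. \<theta> \<in> B \<Longrightarrow> 0 < r \<theta> x" and t: "0 < t"
  shows "emeasure (PiM (UNIV :: nat set) (\<lambda>_. M)) {X \<in> space (PiM (UNIV :: nat set) (\<lambda>_. M)).
           (\<integral>\<^sup>+\<theta>. (\<Prod>i<n. ennreal (r \<theta> (X i))) * indicator B \<theta> \<partial>N) < ennreal (t * measure N B)}
         \<le> ennreal (t / measure N B)
           * (\<integral>\<^sup>+\<theta>. (\<integral>\<^sup>+x. ennreal (1 / r \<theta> x) \<partial>M) ^ n * indicator B \<theta> \<partial>N)"
proof -
  let ?P = "PiM (UNIV :: nat set) (\<lambda>_. M)"
  let ?b = "measure N B"
  interpret N: finite_measure N by fact
  let ?D = "\<lambda>X. \<integral>\<^sup>+\<theta>. (\<Prod>i<n. ennreal (r \<theta> (X i))) * indicator B \<theta> \<partial>N"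
  let ?I = "\<lambda>X. \<integral>\<^sup>+\<theta>. (\<Prod>i<n. ennreal (1 / r \<theta> (X i))) * indicator B \<theta> \<partial>N"
  have I: "?I \<in> borel_measurable ?P"
    "(\<integral>\<^sup>+X. ?I X \<partial>?P) = (\<integral>\<^sup>+\<theta>. (\<integral>\<^sup>+x. ennreal (1 / r \<theta> x) \<partial>M) ^ n * indicator B \<theta> \<partial>N)"
    using nn_integral_mixture_iid_prod[OF M N _ B, of "\<lambda>\<theta> x. ennreal (1 / r \<theta> x)"] by auto
  have "ennreal (?b / t) \<le> ?I X"
    if X: "X \<in> space ?P" and D_lt: "?D X < ennreal (t * ?b)" for X
  proof -
    have Xi: "X i \<in> space M" for i using X by (auto simp: space_PiM)
    have pt: "ennreal (2 * t) * indicator B \<theta>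
        \<le> (\<Prod>i<n. ennreal (r \<theta> (X i))) * indicator B \<theta>
          + ennreal (t\<^sup>2) * ((\<Prod>i<n. ennreal (1 / r \<theta> (X i))) * indicator B \<theta>)" for \<theta>
    proof (cases "\<theta> \<in> B")
      case True
      let ?L = "\<Prod>i<n. r \<theta> (X i)"
      have L: "0 < ?L" using r_pos[OF True] by (intro prod_pos) auto
      have "2 * t \<le> ?L + t\<^sup>2 * (1 / ?L)"
        using L by (rule two_mult_le_add_inverse)
      then have "ennreal (2 * t) \<le> ennreal ?L + ennreal (t\<^sup>2) * ennreal (1 / ?L)"
        using L t by (simp add: ennreal_mult[symmetric] ennreal_plus[symmetric] ennreal_leI del: ennreal_plus)
      then show ?thesis
        using True r_pos[OF True] by (simp add: prod_ennreal less_imp_le prod_dividef)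
    qed simp
    have "ennreal (2 * t * ?b) = (\<integral>\<^sup>+\<theta>. ennreal (2 * t) * indicator B \<theta> \<partial>N)"
      using t by (simp add: nn_integral_cmult N.emeasure_eq_measure ennreal_mult)
    also have "\<dots> \<le> (\<integral>\<^sup>+\<theta>. (\<Prod>i<n. ennreal (r \<theta> (X i))) * indicator B \<theta>
          + ennreal (t\<^sup>2) * ((\<Prod>i<n. ennreal (1 / r \<theta> (X i))) * indicator B \<theta>) \<partial>N)"
      by (intro nn_integral_mono pt)
    also have "\<dots> = ?D X + ennreal (t\<^sup>2) * ?I X"
      using Xi by (subst nn_integral_add) (auto simp: nn_integral_cmult)
    finally have main: "ennreal (2 * t * ?b) \<le> ?D X + ennreal (t\<^sup>2) * ?I X" .
    show ?thesis
    proof (cases "?I X" rule: ennreal_cases)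
      case (real i)
      obtain d where d: "?D X = ennreal d" "0 \<le> d"
        using D_lt by (cases "?D X" rule: ennreal_cases) auto
      have "d < t * ?b" using D_lt d by (simp add: ennreal_less_iff)
      moreover have "2 * t * ?b \<le> d + t\<^sup>2 * i"
        using main d real b t
        by (simp add: ennreal_mult[symmetric] ennreal_plus[symmetric] del: ennreal_plus)
      ultimately have "t * ?b \<le> t * (t * i)" by (simp add: power2_eq_square)
      then have "?b / t \<le> i" using t by (simp add: field_simps)
      then show ?thesis using real by (simp add: ennreal_leI)
    qed simp
  qed
  then have "emeasure ?P {X \<in> space ?P. ?D X < ennreal (t * ?b)}
      \<le> emeasure ?P {X \<in> space ?P. ennreal (?b / t) \<le> ?I X}"
    using I(1) by (intro emeasure_mono) auto
  also have "\<dots> \<le> ennreal (1 / (?b / t)) * (\<integral>\<^sup>+X. ?I X \<partial>?P)"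
    using b t by (intro markov_nn_integral I) auto
  finally show ?thesis by (simp add: I)
qed

section \<open>Gaussian mass of coordinate boxes and finite nets\<close>

text \<open>
  A box of this radius in \<open>k\<close> coordinates has squared \<open>\<ell>\<^sup>2\<close> radius \<open>\<tau>\<^sup>2 / k ^ (2 * p)\<close>, the order of the
  tail of the ellipsoid beyond \<open>k\<close>.
\<close>

definition box_radius :: "nat \<Rightarrow> real \<Rightarrow> nat \<Rightarrow> real" where
  "box_radius p \<tau> k = \<tau> / sqrt (real k ^ (2 * p + 1))"

definition coord_box :: "nat \<Rightarrow> real \<Rightarrow> (nat \<Rightarrow> real) \<Rightarrow> (nat \<Rightarrow> real) set" where
  "coord_box k s \<theta> = {\<eta>. \<forall>j\<in>{1..k}. \<bar>\<eta> j - \<theta> j\<bar> \<le> s}"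

lemma coord_box_measurable [measurable]: "coord_box k s \<theta> \<in> sets (PiM UNIV (\<lambda>_. borel))"
proof -
  have "{\<eta> \<in> space (PiM UNIV (\<lambda>_. borel)). \<forall>j\<in>{1..k}. \<bar>\<eta> j - \<theta> j\<bar> \<le> s} \<in> sets (PiM UNIV (\<lambda>_. borel))"
    by measurable
  then show ?thesis by (simp add: coord_box_def space_PiM)
qed

lemma space_sieve_component [simp]: "space (sieve_component p k) = UNIV"
  using sets_eq_imp_space_eq[OF sets_sieve_component[of p k]] by (simp add: space_PiM)

lemma sets_sieve_coord [simp]: "sets (sieve_coord p k j) = sets borel"
  by (simp add: sieve_coord_def)

text \<open>
  On the interval the Gaussian density is at least its value at a point with square
  \<open>2 * (c\<^sup>2 + s\<^sup>2)\<close>.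
\<close>

lemma sieve_coord_interval_mass:
  fixes p :: nat
  assumes j: "j \<in> {1..k}" and s: "0 \<le> s"
  defines "V \<equiv> real (freq_weight j) ^ (2 * p + 1)"
  shows "ennreal (2 * s * sqrt (V / (2 * pi)) * exp (- (V * (c\<^sup>2 + s\<^sup>2))))
           \<le> emeasure (sieve_coord p k j) {c - s..c + s}"
proof -
  let ?\<sigma> = "sqrt (1 / V)"
  have V: "0 < V" using j by (simp add: V_def freq_weight_def)
  have "ennreal (2 * s * sqrt (V / (2 * pi)) * exp (- (V * (c\<^sup>2 + s\<^sup>2))))
      = ennreal (sqrt (V / (2 * pi)) * exp (- (V * (c\<^sup>2 + s\<^sup>2)))) * emeasure lborel {c - s..c + s}"
    using s V by (simp add: ennreal_mult[symmetric] mult_ac)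
  also have "\<dots> = (\<integral>\<^sup>+x. ennreal (sqrt (V / (2 * pi)) * exp (- (V * (c\<^sup>2 + s\<^sup>2)))) * indicator {c - s..c + s} x \<partial>lborel)"
    by (simp add: nn_integral_cmult)
  also have "\<dots> \<le> (\<integral>\<^sup>+x. ennreal (normal_density 0 ?\<sigma> x) * indicator {c - s..c + s} x \<partial>lborel)"
  proof (rule nn_integral_mono)
    fix x :: real
    show "ennreal (sqrt (V / (2 * pi)) * exp (- (V * (c\<^sup>2 + s\<^sup>2)))) * indicator {c - s..c + s} x
        \<le> ennreal (normal_density 0 ?\<sigma> x) * indicator {c - s..c + s} x"
    proof (cases "x \<in> {c - s..c + s}")
      case True
      then have "\<bar>x - c\<bar> \<le> s" by (auto simp: abs_le_iff)
      then have "(x - c)\<^sup>2 \<le> s\<^sup>2" using power_mono[of "\<bar>x - c\<bar>" s 2] by simp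
      then have "x\<^sup>2 \<le> 2 * (c\<^sup>2 + s\<^sup>2)" using power2_diff_le[of "x - c" "- c"] by simp
      then have "- (V * (c\<^sup>2 + s\<^sup>2)) \<le> - (V * (x\<^sup>2 / 2))"
        using V by (intro le_imp_neg_le mult_left_mono) auto
      moreover have "normal_density 0 ?\<sigma> x = sqrt (V / (2 * pi)) * exp (- (V * (x\<^sup>2 / 2)))"
        using V by (simp add: normal_density_def real_sqrt_divide field_simps)
      ultimately show ?thesis using V True
        by (auto intro!: ennreal_leI mult_left_mono)
    qed simp
  qed
  also have "\<dots> = emeasure (sieve_coord p k j) {c - s..c + s}"
    using j by (simp add: sieve_coord_def emeasure_density V_def)
  finally show ?thesis .
qed

lemma power_div_fact_le_exp:
  fixes x :: real
  assumes "0 \<le> x"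
  shows "x ^ n / fact n \<le> exp x"
proof -
  have "(\<Sum>i\<in>{n}. x ^ i /\<^sub>R fact i) \<le> (\<Sum>i. x ^ i /\<^sub>R fact i)"
    using assms by (intro sum_le_suminf summable_exp_generic) auto
  then show ?thesis by (simp add: exp_def divide_inverse mult.commute)
qed

text \<open>
  The prior standard deviation of coordinate \<open>j\<close> is of order \<open>j powr (- p - 1/2)\<close>, so the
  lengths of the sides relative to it multiply, up to a factor \<open>\<kappa> ^ k\<close>, to at least a fixed power of
  \<open>k! / k ^ k\<close>, hence of \<open>exp (- k)\<close>.
  The Gaussian exponents sum to at most a multiple of \<open>k\<close>, since
  \<open>v\<^sub>j ^ (2 * p + 1) * \<theta>\<^sub>j\<^sup>2 \<le> 2 * k * v\<^sub>j ^ (2 * p) * \<theta>\<^sub>j\<^sup>2\<close>.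
\<close>

lemma sieve_box_mass:
  assumes \<tau>: "0 < \<tau>" and Q: "0 < Q"
  obtains C where "0 < C"
    and "\<And>k \<theta>. k \<ge> 1 \<Longrightarrow> \<theta> \<in> sobolev_ellipsoid p Q \<Longrightarrow>
      exp (- C * real k) \<le> measure (sieve_component p k) (coord_box k (box_radius p \<tau> k) \<theta>)"
proof
  define \<kappa> where "\<kappa> = 2 * \<tau> / sqrt (2 * pi)"
  define C where "C = \<bar>ln \<kappa>\<bar> + real (p + 1) + 2 * Q + 2 ^ (2 * p + 1) * \<tau>\<^sup>2"
  have \<kappa>: "0 < \<kappa>" using \<tau> by (simp add: \<kappa>_def)
  show "0 < C" using Q by (simp add: C_def add_pos_nonneg add_nonneg_pos)
  fix k :: nat and \<theta> assume k: "k \<ge> 1" and \<theta>: "\<theta> \<in> sobolev_ellipsoid p Q"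
  define s where "s = box_radius p \<tau> k"
  define V where "V = (\<lambda>j. real (freq_weight j) ^ (2 * p + 1))"
  interpret product_prob_space "sieve_coord p k" UNIV
    by (intro product_prob_spaceI prob_space_sieve_coord)
  have k0: "0 < real k" using k by simp
  have s0: "0 < s" using \<tau> k by (simp add: s_def box_radius_def)
  have s2: "s\<^sup>2 = \<tau>\<^sup>2 / real k ^ (2 * p + 1)"
    using k by (simp add: s_def box_radius_def power_divide)
  have "measure (sieve_component p k) (coord_box k s \<theta>)
      = measure (PiM UNIV (sieve_coord p k)) {\<eta> \<in> space (PiM UNIV (sieve_coord p k)).
          \<forall>j\<in>{1..k}. \<eta> j \<in> {\<theta> j - s..\<theta> j + s}}"
    using space_sieve_component[of p k]
    by (auto simp: sieve_component_def coord_box_def abs_le_iff intro!: arg_cong2[where f=measure])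
  also have "\<dots> = (\<Prod>j\<in>{1..k}. measure (sieve_coord p k j) {\<theta> j - s..\<theta> j + s})"
  proof -
    have M: "emeasure (sieve_coord p k j) I = ennreal (measure (sieve_coord p k j) I)" for j I
      by (rule finite_measure.emeasure_eq_measure)
        (rule prob_space.finite_measure[OF prob_space_sieve_coord])
    show ?thesis
      unfolding measure_def[of "PiM UNIV (sieve_coord p k)"]
      by (subst emeasure_PiM_Collect) (auto simp: M prod_ennreal prod_nonneg)
  qed
  also have "\<dots> \<ge> (\<Prod>j\<in>{1..k}. \<kappa> * (real j / real k) ^ (p + 1) * exp (- (V j * ((\<theta> j)\<^sup>2 + s\<^sup>2))))"
  proof (intro prod_mono conjI)
    fix j assume j: "j \<in> {1..k}"
    show "0 \<le> \<kappa> * (real j / real k) ^ (p + 1) * exp (- (V j * ((\<theta> j)\<^sup>2 + s\<^sup>2)))"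
      using \<kappa> by simp
    \<comment> \<open>Raising the exponent from \<open>p + 1/2\<close> to \<open>p + 1\<close> only decreases a power of \<open>j / k \<le> 1\<close>.\<close>
    have "(real j / real k) ^ (p + 1) = sqrt (((real j / real k) ^ (p + 1))\<^sup>2)"
      by (simp del: power_Suc)
    also have "\<dots> = sqrt ((real j / real k) ^ (2 * p + 2))"
      by (simp only: power_mult[symmetric]) (simp add: mult.commute)
    also have "\<dots> \<le> sqrt ((real j / real k) ^ (2 * p + 1))"
      using j by (intro real_sqrt_le_mono power_decreasing) auto
    also have "\<dots> \<le> sqrt (V j / real k ^ (2 * p + 1))"
      unfolding power_divide V_def using freq_weight_ge[of j]
      by (intro real_sqrt_le_mono divide_right_mono power_mono) auto
    finally have "\<kappa> * (real j / real k) ^ (p + 1) \<le> \<kappa> * sqrt (V j / real k ^ (2 * p + 1))"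
      using \<kappa> by (intro mult_left_mono) auto
    also have "\<dots> = 2 * s * sqrt (V j / (2 * pi))"
      by (simp add: \<kappa>_def s_def box_radius_def real_sqrt_divide real_sqrt_mult)
    finally have "\<kappa> * (real j / real k) ^ (p + 1) * exp (- (V j * ((\<theta> j)\<^sup>2 + s\<^sup>2)))
        \<le> 2 * s * sqrt (V j / (2 * pi)) * exp (- (V j * ((\<theta> j)\<^sup>2 + s\<^sup>2)))"
      by (intro mult_right_mono) auto
    also have "\<dots> \<le> measure (sieve_coord p k j) {\<theta> j - s..\<theta> j + s}"
      using sieve_coord_interval_mass[OF j less_imp_le[OF s0], of p "\<theta> j"]
      by (simp add: V_def finite_measure.emeasure_eq_measure[OF prob_space.finite_measure[OF prob_space_sieve_coord]])
    finally show "\<kappa> * (real j / real k) ^ (p + 1) * exp (- (V j * ((\<theta> j)\<^sup>2 + s\<^sup>2)))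
        \<le> measure (sieve_coord p k j) {\<theta> j - s..\<theta> j + s}" .
  qed
  also have "(\<Prod>j\<in>{1..k}. \<kappa> * (real j / real k) ^ (p + 1) * exp (- (V j * ((\<theta> j)\<^sup>2 + s\<^sup>2))))
      = \<kappa> ^ k * (\<Prod>j\<in>{1..k}. real j / real k) ^ (p + 1) * exp (- (\<Sum>j\<in>{1..k}. V j * ((\<theta> j)\<^sup>2 + s\<^sup>2)))"
    by (simp add: prod.distrib prod_power_distrib exp_sum[symmetric] sum_negf del: power_Suc)
  also have "\<dots> \<ge> exp (- (\<bar>ln \<kappa>\<bar> * real k)) * exp (- real k) ^ (p + 1)
                   * exp (- ((2 * Q + 2 ^ (2 * p + 1) * \<tau>\<^sup>2) * real k))"
  proof (intro mult_mono power_mono)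
    have "exp (- (\<bar>ln \<kappa>\<bar> * real k)) \<le> exp (ln \<kappa> * real k)"
      by (auto simp: abs_if mult_nonneg_nonpos2 not_less mult_nonneg_nonneg)
    also have "\<dots> = \<kappa> ^ k"
      using \<kappa> by (simp add: exp_of_nat2_mult)
    finally show "exp (- (\<bar>ln \<kappa>\<bar> * real k)) \<le> \<kappa> ^ k" .
    have prod_eq: "(\<Prod>j\<in>{1..k}. real j / real k) = fact k / real k ^ k"
      by (simp add: prod_dividef fact_prod)
    show "exp (- real k) \<le> (\<Prod>j\<in>{1..k}. real j / real k)"
      unfolding prod_eq using power_div_fact_le_exp[of "real k" k] k0 by (simp add: exp_minus field_simps)
    have "(\<Sum>j\<in>{1..k}. V j * ((\<theta> j)\<^sup>2 + s\<^sup>2))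
        \<le> (\<Sum>j\<in>{1..k}. 2 * real k * (real (freq_weight j) ^ (2 * p) * (\<theta> j)\<^sup>2) + 2 ^ (2 * p + 1) * \<tau>\<^sup>2)"
    proof (rule sum_mono)
      fix j assume j: "j \<in> {1..k}"
      have fw: "real (freq_weight j) \<le> 2 * real k" using freq_weight_le[of j] j by simp
      have "V j * (\<theta> j)\<^sup>2 \<le> 2 * real k * (real (freq_weight j) ^ (2 * p) * (\<theta> j)\<^sup>2)"
        using mult_right_mono[OF fw, of "real (freq_weight j) ^ (2 * p) * (\<theta> j)\<^sup>2"]
        by (simp add: V_def mult_ac)
      moreover have "V j * s\<^sup>2 \<le> 2 ^ (2 * p + 1) * \<tau>\<^sup>2"
      proof -
        have "V j * s\<^sup>2 \<le> (2 * real k) ^ (2 * p + 1) * s\<^sup>2"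
          unfolding V_def using fw by (intro mult_right_mono power_mono) auto
        also have "\<dots> = 2 ^ (2 * p + 1) * \<tau>\<^sup>2"
          unfolding s2 power_mult_distrib using k0 by simp
        finally show ?thesis .
      qed
      ultimately show "V j * ((\<theta> j)\<^sup>2 + s\<^sup>2)
          \<le> 2 * real k * (real (freq_weight j) ^ (2 * p) * (\<theta> j)\<^sup>2) + 2 ^ (2 * p + 1) * \<tau>\<^sup>2"
        by (simp add: distrib_left)
    qed
    also have "\<dots> = 2 * real k * (\<Sum>j\<in>{1..k}. real (freq_weight j) ^ (2 * p) * (\<theta> j)\<^sup>2)
        + 2 ^ (2 * p + 1) * \<tau>\<^sup>2 * real k"
      by (simp add: sum.distrib sum_distrib_left)
    also have "(\<Sum>j\<in>{1..k}. real (freq_weight j) ^ (2 * p) * (\<theta> j)\<^sup>2)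
        \<le> (\<Sum>j. real (freq_weight j) ^ (2 * p) * (\<theta> j)\<^sup>2)"
      using \<theta> by (intro sum_le_suminf) (auto simp: sobolev_ellipsoid_def)
    also have "\<dots> \<le> Q" using \<theta> by (simp add: sobolev_ellipsoid_def)
    finally have "(\<Sum>j\<in>{1..k}. V j * ((\<theta> j)\<^sup>2 + s\<^sup>2)) \<le> (2 * Q + 2 ^ (2 * p + 1) * \<tau>\<^sup>2) * real k"
      using k0 by (simp add: algebra_simps)
    then show "exp (- ((2 * Q + 2 ^ (2 * p + 1) * \<tau>\<^sup>2) * real k))
        \<le> exp (- (\<Sum>j\<in>{1..k}. V j * ((\<theta> j)\<^sup>2 + s\<^sup>2)))" by simp
  qed (use \<kappa> in \<open>auto intro!: prod_nonneg mult_nonneg_nonneg zero_le_power\<close>)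
  also have "exp (- (\<bar>ln \<kappa>\<bar> * real k)) * exp (- real k) ^ (p + 1)
      * exp (- ((2 * Q + 2 ^ (2 * p + 1) * \<tau>\<^sup>2) * real k)) = exp (- C * real k)"
    unfolding exp_of_nat_mult[symmetric] exp_add[symmetric] by (simp add: C_def algebra_simps)
  finally show "exp (- C * real k) \<le> measure (sieve_component p k) (coord_box k (box_radius p \<tau> k) \<theta>)"
    by (simp add: s_def)
qed

text \<open>
  Disjoint boxes of mass at least \<open>exp (- c)\<close> number at most \<open>exp c\<close>, so a family of centres in \<open>A\<close>
  with disjoint boxes and maximal cardinality exists; by maximality the box of any further point of \<open>A\<close>
  meets one of them.
\<close>

lemma finite_net_of_box_mass:
  assumes C: "\<And>\<theta>. \<theta> \<in> A \<Longrightarrow> exp (- c) \<le> measure (sieve_component p k) (coord_box k s \<theta>)" and s: "0 \<le> s"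
  obtains T where "finite T" "T \<subseteq> A" "real (card T) \<le> exp c"
    "\<And>\<theta>. \<theta> \<in> A \<Longrightarrow> \<exists>t\<in>T. \<theta> \<in> coord_box k (2 * s) t"
proof -
  interpret prob_space "sieve_component p k" by (rule prob_space_sieve_component)
  define P where "P = (\<lambda>T. finite T \<and> T \<subseteq> A \<and> disjoint_family_on (coord_box k s) T)"
  have card_le: "real (card T) \<le> exp c" if T: "P T" for T
  proof -
    have "real (card T) * exp (- c) \<le> (\<Sum>t\<in>T. prob (coord_box k s t))"
      using C T by (intro sum_bounded_below) (auto simp: P_def)
    also have "\<dots> = prob (\<Union>t\<in>T. coord_box k s t)"
      using T by (intro finite_measure_finite_Union[symmetric]) (auto simp: P_def)
    also have "\<dots> \<le> 1" by simp
    finally show ?thesis by (simp add: exp_minus field_simps)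
  qed
  have "\<exists>T. P T \<and> (\<forall>T'. P T' \<longrightarrow> card T' \<le> card T)"
  proof (rule ex_has_greatest_nat)
    show "P {}" by (simp add: P_def disjoint_family_on_def)
    show "\<forall>T. P T \<longrightarrow> card T < Suc (nat \<lfloor>exp c\<rfloor>)"
      using card_le by (auto simp: less_Suc_eq_le le_nat_floor)
  qed
  then obtain T where T: "P T" and max: "\<And>T'. P T' \<Longrightarrow> card T' \<le> card T" by blast
  show thesis
  proof (rule that)
    show "finite T" "T \<subseteq> A" "real (card T) \<le> exp c"
      using T card_le by (auto simp: P_def)
    fix \<theta> assume \<theta>: "\<theta> \<in> A"
    show "\<exists>t\<in>T. \<theta> \<in> coord_box k (2 * s) t"
    proof (cases "\<theta> \<in> T")
      case True
      then show ?thesis using s by (auto simp: coord_box_def intro!: bexI[of _ \<theta>])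
    next
      case False
      then have "card (insert \<theta> T) > card T" using T by (simp add: P_def)
      then have "\<not> P (insert \<theta> T)" using max[of "insert \<theta> T"] by linarith
      then have "\<not> disjoint_family_on (coord_box k s) (insert \<theta> T)"
        using T \<theta> by (auto simp: P_def)
      then obtain t \<eta> where t: "t \<in> T" "\<eta> \<in> coord_box k s \<theta>" "\<eta> \<in> coord_box k s t"
        using T False by (auto simp: P_def disjoint_family_on_insert)
      have "\<theta> \<in> coord_box k (2 * s) t"
        unfolding coord_box_def
      proof safe
        fix j assume j: "j \<in> {1..k}"
        have "\<bar>\<eta> j - \<theta> j\<bar> \<le> s" "\<bar>\<eta> j - t j\<bar> \<le> s"
          using t(2,3) j by (auto simp: coord_box_def)
        then show "\<bar>\<theta> j - t j\<bar> \<le> 2 * s" by linarith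
      qed
      then show ?thesis using t(1) by blast
    qed
  qed
qed

section \<open>Mass of neighbourhoods under the sieve prior\<close>

lemma AE_sieve_component_zero:
  "AE \<eta> in sieve_component p k. \<forall>j. j \<notin> {1..k} \<longrightarrow> \<eta> j = 0"
  unfolding sieve_component_def AE_all_countable
proof
  fix j
  show "AE \<eta> in PiM UNIV (sieve_coord p k). j \<notin> {1..k} \<longrightarrow> \<eta> j = 0"
  proof (cases "j \<in> {1..k}")
    case False
    then have eq: "sieve_coord p k j = return borel 0"
      by (auto simp: sieve_coord_def)
    have "AE x in sieve_coord p k j. x = 0"
      unfolding eq by (subst AE_return) auto
    then have "AE \<eta> in PiM UNIV (sieve_coord p k). \<eta> j = 0"
      by (intro AE_PiM_component prob_space_sieve_coord) auto
    then show ?thesis by simp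
  qed simp
qed

lemma sets_sieve_prior [simp]: "sets (sieve_prior p lam) = sets (PiM UNIV (\<lambda>_. borel))"
  unfolding sieve_prior_def by (rule sets_bind) auto

lemma prob_space_sieve_prior: "prob_space (sieve_prior p lam)"
  unfolding sieve_prior_def
proof (rule measure_pmf.prob_space_bind)
  show "sieve_component p \<in> measurable (measure_pmf lam) (subprob_algebra (PiM UNIV (\<lambda>_. borel)))"
    by (auto simp: space_subprob_algebra prob_space_sieve_component prob_space_imp_subprob_space)
qed (simp add: prob_space_sieve_component)

lemma sieve_prior_mass_ge:
  assumes "A \<in> sets (PiM UNIV (\<lambda>_. borel))"
  shows "pmf lam k * measure (sieve_component p k) A \<le> measure (sieve_prior p lam) A"
proof -
  interpret prior: prob_space "sieve_prior p lam" by (rule prob_space_sieve_prior)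
  interpret comp: prob_space "sieve_component p k" by (rule prob_space_sieve_component)
  let ?m = "\<lambda>k. ennreal (pmf lam k) * emeasure (sieve_component p k) A"
  have "(\<Sum>i\<in>{k}. ?m i) \<le> (\<Sum>i. ?m i)"
    by (rule sum_le_suminf) auto
  then have "ennreal (pmf lam k * measure (sieve_component p k) A) \<le> ennreal (prior.prob A)"
    using emeasure_sieve_prior[OF assms, of p lam]
    by (simp add: comp.emeasure_eq_measure prior.emeasure_eq_measure ennreal_mult)
  then show ?thesis by simp
qed

lemma power2_add_le_weighted:
  fixes a b e :: real
  assumes "0 < e"
  shows "(a + b)\<^sup>2 \<le> (1 + e) * a\<^sup>2 + (1 + 1 / e) * b\<^sup>2"
proof -
  have "2 * (sqrt e * a) * (b / sqrt e) \<le> (sqrt e * a)\<^sup>2 + (b / sqrt e)\<^sup>2"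
    by (rule sum_squares_bound)
  then have "2 * a * b \<le> e * a\<^sup>2 + b\<^sup>2 / e"
    using assms by (simp add: power_mult_distrib power_divide)
  then show ?thesis by (simp add: power2_sum algebra_simps)
qed

text \<open>
  The ellipsoid is defined by a strict inequality, and the perturbation changes the Sobolev norm by an
  amount that is small with \<open>\<tau>\<close>, uniformly in \<open>k\<close>.
\<close>

lemma small_box_subset_ellipsoid:
  assumes \<theta>: "\<theta> \<in> sobolev_ellipsoid p Q"
  obtains \<tau> where "0 < \<tau>"
    and "\<And>k \<eta>. k \<ge> 1 \<Longrightarrow> \<eta> \<in> coord_box k (box_radius p \<tau> k) \<theta> \<Longrightarrow>
      (\<And>j. j \<notin> {1..k} \<Longrightarrow> \<eta> j = 0) \<Longrightarrow> \<eta> \<in> sobolev_ellipsoid p Q"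
proof
  let ?w = "\<lambda>j. real (freq_weight j) ^ (2 * p)"
  define q where "q = (\<Sum>j. ?w j * (\<theta> j)\<^sup>2)"
  have sum: "summable (\<lambda>j. ?w j * (\<theta> j)\<^sup>2)" and qQ: "q < Q"
    using \<theta> by (auto simp: sobolev_ellipsoid_def q_def)
  have q0: "0 \<le> q" unfolding q_def by (intro suminf_nonneg sum) auto
  define e where "e = (Q - q) / (2 * Q)"
  define c where "c = (1 + 1 / e) * 4 ^ p"
  \<comment> \<open>\<open>e\<close> and \<open>\<tau>\<close> are chosen so that the inflated norm \<open>(1 + e) * q\<close> and the cost of the perturbation
    use up half and a quarter of the slack \<open>Q - q\<close>.\<close>
  define \<tau> where "\<tau> = sqrt ((Q - q) / (4 * c))"
  have Q: "0 < Q" and e: "0 < e" using q0 qQ by (auto simp: e_def)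
  have c: "0 < c" using e by (simp add: c_def add_pos_pos)
  show "0 < \<tau>" using c qQ by (simp add: \<tau>_def)
  fix k :: nat and \<eta>
  assume k: "k \<ge> 1" and box: "\<eta> \<in> coord_box k (box_radius p \<tau> k) \<theta>"
    and zero: "\<And>j. j \<notin> {1..k} \<Longrightarrow> \<eta> j = 0"
  define s where "s = box_radius p \<tau> k"
  have s2: "s\<^sup>2 = \<tau>\<^sup>2 / real k ^ (2 * p + 1)"
    using k by (simp add: s_def box_radius_def power_divide)
  have term_le: "?w j * (\<eta> j)\<^sup>2 \<le> (1 + e) * (?w j * (\<theta> j)\<^sup>2) + (1 + 1 / e) * (4 ^ p * \<tau>\<^sup>2 / real k)"
    if j: "j \<in> {1..k}" for j
  proof -
    have "\<bar>\<eta> j - \<theta> j\<bar> \<le> s" using box j by (auto simp: coord_box_def s_def)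
    then have d: "(\<eta> j - \<theta> j)\<^sup>2 \<le> s\<^sup>2" using power_mono[of "\<bar>\<eta> j - \<theta> j\<bar>" s 2] by simp
    have "?w j \<le> (2 * real k) ^ (2 * p)"
      using freq_weight_le[of j] j by (intro power_mono) auto
    then have "?w j * (\<eta> j - \<theta> j)\<^sup>2 \<le> (2 * real k) ^ (2 * p) * s\<^sup>2"
      using d by (intro mult_mono) auto
    also have "\<dots> = 4 ^ p * \<tau>\<^sup>2 / real k"
      using k by (simp add: s2 power_mult_distrib power_mult[of 2 2 p])
    finally have wd: "?w j * (\<eta> j - \<theta> j)\<^sup>2 \<le> 4 ^ p * \<tau>\<^sup>2 / real k" .
    have "?w j * (\<eta> j)\<^sup>2 \<le> ?w j * ((1 + e) * (\<theta> j)\<^sup>2 + (1 + 1 / e) * (\<eta> j - \<theta> j)\<^sup>2)"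
      using power2_add_le_weighted[OF e, of "\<theta> j" "\<eta> j - \<theta> j"] by (intro mult_left_mono) auto
    also have "\<dots> = (1 + e) * (?w j * (\<theta> j)\<^sup>2) + (1 + 1 / e) * (?w j * (\<eta> j - \<theta> j)\<^sup>2)"
      by (simp add: distrib_left mult_ac)
    also have "\<dots> \<le> (1 + e) * (?w j * (\<theta> j)\<^sup>2) + (1 + 1 / e) * (4 ^ p * \<tau>\<^sup>2 / real k)"
      using wd e by (intro add_left_mono mult_left_mono) auto
    finally show ?thesis .
  qed
  have "(\<Sum>j. ?w j * (\<eta> j)\<^sup>2) = (\<Sum>j\<in>{1..k}. ?w j * (\<eta> j)\<^sup>2)"
    using zero by (intro suminf_finite) auto
  also have "\<dots> \<le> (\<Sum>j\<in>{1..k}. (1 + e) * (?w j * (\<theta> j)\<^sup>2) + (1 + 1 / e) * (4 ^ p * \<tau>\<^sup>2 / real k))"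
    by (intro sum_mono term_le)
  also have "\<dots> = (1 + e) * (\<Sum>j\<in>{1..k}. ?w j * (\<theta> j)\<^sup>2) + c * \<tau>\<^sup>2"
    using k by (simp add: sum.distrib sum_distrib_left c_def)
  also have "(\<Sum>j\<in>{1..k}. ?w j * (\<theta> j)\<^sup>2) \<le> q"
    unfolding q_def by (intro sum_le_suminf sum) auto
  also have "c * \<tau>\<^sup>2 = (Q - q) / 4"
    using c qQ by (simp add: \<tau>_def)
  also have "(1 + e) * q + (Q - q) / 4 < Q"
  proof -
    have "e * q \<le> e * Q" using qQ e by (intro mult_left_mono) auto
    also have "e * Q = (Q - q) / 2" using Q by (simp add: e_def)
    finally have "e * q \<le> (Q - q) / 2" .
    then have "(1 + e) * q + (Q - q) / 4 \<le> q + (Q - q) / 2 + (Q - q) / 4"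
      by (simp only: distrib_right mult_1_left add_le_cancel_right add_le_cancel_left)
    also have "\<dots> = Q - (Q - q) / 4" by (simp add: field_simps)
    also have "\<dots> < Q" using qQ by simp
    finally show ?thesis .
  qed
  finally have "(\<Sum>j. ?w j * (\<eta> j)\<^sup>2) < Q" using e by simp
  moreover have "summable (\<lambda>j. ?w j * (\<eta> j)\<^sup>2)" "summable (\<lambda>j. (\<eta> j)\<^sup>2)"
    using zero by (auto intro!: summable_finite[of "{1..k}"])
  ultimately show "\<eta> \<in> sobolev_ellipsoid p Q" by (simp add: sobolev_ellipsoid_def)
qed

text \<open>
  Under the \<open>k\<close>-th component of the sieve almost every sequence vanishes outside the first \<open>k\<close>
  coordinates, so membership in the ellipsoid needs to be checked for such sequences only.
\<close>

lemma sieve_component_box_eq: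
  assumes sub: "\<And>\<eta>. \<eta> \<in> coord_box k s \<theta> \<Longrightarrow> (\<And>j. j \<notin> {1..k} \<Longrightarrow> \<eta> j = 0) \<Longrightarrow> \<eta> \<in> sobolev_ellipsoid p Q"
  shows "measure (sieve_component p k) (sobolev_ellipsoid p Q \<inter> coord_box k s \<theta>)
    = measure (sieve_component p k) (coord_box k s \<theta>)"
proof -
  interpret prob_space "sieve_component p k" by (rule prob_space_sieve_component)
  show ?thesis
  proof (rule finite_measure_eq_AE)
    show "AE \<eta> in sieve_component p k.
        (\<eta> \<in> sobolev_ellipsoid p Q \<inter> coord_box k s \<theta>) = (\<eta> \<in> coord_box k s \<theta>)"
      using AE_sieve_component_zero[where p=p and k=k] by (rule eventually_mono) (use sub in blast)
  qed auto
qed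

lemma restricted_prior_mass_ge:
  assumes E: "measure (sieve_prior p lam) (sobolev_ellipsoid p Q) > 0"
    and A: "A \<in> sets (PiM UNIV (\<lambda>_. borel))"
  shows "measure (sieve_prior p lam) (sobolev_ellipsoid p Q \<inter> A) \<le> measure (restricted_prior p Q lam) A"
proof -
  interpret prior: prob_space "sieve_prior p lam" by (rule prob_space_sieve_prior)
  have "measure (restricted_prior p Q lam) A
      = measure (sieve_prior p lam) (sobolev_ellipsoid p Q \<inter> A) / measure (sieve_prior p lam) (sobolev_ellipsoid p Q)"
    unfolding restricted_prior_def
    using E A by (intro measure_uniform_measure) (auto simp: prior.emeasure_eq_measure)
  also have "\<dots> \<ge> measure (sieve_prior p lam) (sobolev_ellipsoid p Q \<inter> A)"
    using E by (simp add: le_divide_eq mult_left_le)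
  finally show ?thesis .
qed

section \<open>Numerator and denominator of the posterior\<close>

text \<open>
  A law determines its density only almost everywhere, which is enough for the Hellinger
  distance.
\<close>

lemma hellinger_cong_exp_model:
  assumes "exp_model \<eta> = exp_model \<zeta>"
  shows "hellinger (exp_density \<theta>) (exp_density \<eta>) = hellinger (exp_density \<theta>) (exp_density \<zeta>)"
proof -
  have "AE x in unit_lborel. ennreal (exp_density \<eta> x) = ennreal (exp_density \<zeta> x)"
    using assms unfolding exp_model_def by (intro unit.density_unique) auto
  then have ae: "AE x in unit_lborel. exp_density \<eta> x = exp_density \<zeta> x"
    by (simp add: exp_density_nonneg)
  have "(\<integral>x. (sqrt (exp_density \<theta> x) - sqrt (exp_density \<eta> x))\<^sup>2 \<partial>unit_lborel)
      = (\<integral>x. (sqrt (exp_density \<theta> x) - sqrt (exp_density \<zeta> x))\<^sup>2 \<partial>unit_lborel)"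
    using ae by (intro integral_cong_AE) auto
  then show ?thesis by (simp add: hellinger_def)
qed

definition far_set :: "nat \<Rightarrow> real \<Rightarrow> (nat \<Rightarrow> real) \<Rightarrow> real \<Rightarrow> (nat \<Rightarrow> real) set" where
  "far_set p Q \<theta> h = {\<eta> \<in> sobolev_ellipsoid p Q. h < hellinger (exp_density \<theta>) (exp_density \<eta>)}"

lemma far_set_eq:
  "{\<eta> \<in> sobolev_ellipsoid p Q. exp_model \<eta> \<in>
      {exp_model \<zeta> | \<zeta>. \<zeta> \<in> sobolev_ellipsoid p Q \<and> h < hellinger (exp_density \<theta>) (exp_density \<zeta>)}}
    = far_set p Q \<theta> h"
proof -
  have "(\<exists>\<zeta>. exp_model \<eta> = exp_model \<zeta> \<and> \<zeta> \<in> sobolev_ellipsoid p Q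
          \<and> h < hellinger (exp_density \<theta>) (exp_density \<zeta>))
      \<longleftrightarrow> h < hellinger (exp_density \<theta>) (exp_density \<eta>)"
    if "\<eta> \<in> sobolev_ellipsoid p Q" for \<eta>
  proof
    assume "\<exists>\<zeta>. exp_model \<eta> = exp_model \<zeta> \<and> \<zeta> \<in> sobolev_ellipsoid p Q
        \<and> h < hellinger (exp_density \<theta>) (exp_density \<zeta>)"
    then obtain \<zeta> where \<zeta>: "exp_model \<eta> = exp_model \<zeta>"
        "h < hellinger (exp_density \<theta>) (exp_density \<zeta>)" by (elim exE conjE)
    show "h < hellinger (exp_density \<theta>) (exp_density \<eta>)"
      unfolding hellinger_cong_exp_model[OF \<zeta>(1)] by (rule \<zeta>(2))
  next
    assume h: "h < hellinger (exp_density \<theta>) (exp_density \<eta>)"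
    show "\<exists>\<zeta>. exp_model \<eta> = exp_model \<zeta> \<and> \<zeta> \<in> sobolev_ellipsoid p Q
        \<and> h < hellinger (exp_density \<theta>) (exp_density \<zeta>)"
      by (intro exI[of _ \<eta>] conjI refl that h)
  qed
  then show ?thesis unfolding far_set_def mem_Collect_eq by (rule Collect_cong[OF conj_cong[OF refl]])
qed

lemma far_set_measurable [measurable]: "far_set p Q \<theta> h \<in> sets (PiM UNIV (\<lambda>_. borel))"
proof -
  let ?\<Theta> = "PiM UNIV (\<lambda>_. borel) :: (nat \<Rightarrow> real) measure"
  note exp_density_joint_measurable [measurable]
  have "(\<lambda>\<eta>. hellinger (exp_density \<theta>) (exp_density \<eta>)) \<in> borel_measurable ?\<Theta>"
    unfolding hellinger_def by measurable
  then have "{\<eta> \<in> space ?\<Theta>. h < hellinger (exp_density \<theta>) (exp_density \<eta>)} \<in> sets ?\<Theta>"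
    by measurable
  then have "sobolev_ellipsoid p Q \<inter> {\<eta> \<in> space ?\<Theta>. h < hellinger (exp_density \<theta>) (exp_density \<eta>)} \<in> sets ?\<Theta>"
    by (intro sets.Int sobolev_ellipsoid_measurable)
  also have "sobolev_ellipsoid p Q \<inter> {\<eta> \<in> space ?\<Theta>. h < hellinger (exp_density \<theta>) (exp_density \<eta>)} = far_set p Q \<theta> h"
    by (auto simp: far_set_def space_PiM)
  finally show ?thesis .
qed

lemma density_ratio_measurable:
  assumes "sets N = sets (PiM UNIV (\<lambda>_. borel))"
  shows "(\<lambda>(\<eta>, x). exp_density \<eta> x / exp_density \<theta> x) \<in> borel_measurable (N \<Otimes>\<^sub>M exp_model \<theta>)"
proof -
  note exp_density_joint_measurable [measurable]
  have "(\<lambda>(\<eta>, x). exp_density \<eta> x / exp_density \<theta> x) \<in> borel_measurable (PiM UNIV (\<lambda>_. borel) \<Otimes>\<^sub>M unit_lborel)"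
    by measurable
  moreover have "sets (N \<Otimes>\<^sub>M exp_model \<theta>) = sets (PiM UNIV (\<lambda>_. borel) \<Otimes>\<^sub>M unit_lborel)"
    by (intro sets_pair_measure_cong assms) simp
  ultimately show ?thesis by (subst measurable_cong_sets) auto
qed

text \<open>
  The values are extended nonnegative reals, so that Tonelli's theorem and Markov's inequality apply without integrability.
\<close>

abbreviation lik_integral ::
    "(nat \<Rightarrow> real) measure \<Rightarrow> (nat \<Rightarrow> real) \<Rightarrow> nat \<Rightarrow> (nat \<Rightarrow> real) set \<Rightarrow> (nat \<Rightarrow> real) \<Rightarrow> ennreal" where
  "lik_integral N \<theta> n A X \<equiv>
     \<integral>\<^sup>+\<eta>. (\<Prod>i<n. ennreal (exp_density \<eta> (X i) / exp_density \<theta> (X i))) * indicator A \<eta> \<partial>N"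

lemma lik_integral_measurable:
  assumes p: "p \<ge> 1" and \<theta>: "\<theta> \<in> sobolev_ellipsoid p Q"
    and N: "prob_space N" and sN: "sets N = sets (PiM UNIV (\<lambda>_. borel))" and A: "A \<in> sets N"
  shows "lik_integral N \<theta> n A \<in> borel_measurable (PiM UNIV (\<lambda>_. exp_model \<theta>))"
  using nn_integral_mixture_iid_prod(1)[OF prob_space_exp_model[OF p \<theta>] prob_space.finite_measure[OF N] _ A,
      of "\<lambda>\<eta> x. ennreal (exp_density \<eta> x / exp_density \<theta> x)" n]
    measurable_compose[OF density_ratio_measurable[OF sN, of \<theta>] measurable_ennreal]
  by (simp add: split_beta')

text \<open>
  A union bound over the cells of the net.  In the cell of \<open>t\<close>, at Hellinger distance \<open>H\<close> from the
  truth, the thresholds \<open>u = exp (- n * H\<^sup>2 / 2)\<close> and \<open>c = exp (- n * H\<^sup>2 / 8)\<close> balance the affinity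
  \<open>exp (- n * H\<^sup>2 / 2)\<close> against the growth \<open>exp (n * H\<^sup>2 / 4)\<close> within the cell.
\<close>

lemma far_set_evidence_tail:
  assumes p: "p \<ge> 1" and \<theta>: "\<theta> \<in> sobolev_ellipsoid p Q"
    and N: "prob_space N" and sN: "sets N = sets (PiM UNIV (\<lambda>_. borel))"
    and T: "finite T" "T \<subseteq> far_set p Q \<theta> h" and h: "0 \<le> h"
    and cover: "\<And>\<eta>. \<eta> \<in> far_set p Q \<theta> h \<Longrightarrow> \<exists>t\<in>T. \<eta> \<in> coord_box k s t" and k: "k \<ge> 1"
    and radius: "256 * exp (14 * log_bound Q) * (real k * s\<^sup>2 + 4 * Q / real k ^ (2 * p)) \<le> h\<^sup>2"
  shows "emeasure (PiM UNIV (\<lambda>_. exp_model \<theta>)) {X \<in> space (PiM UNIV (\<lambda>_. exp_model \<theta>)).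
      ennreal (real (card T) * exp (- real n * h\<^sup>2 / 8)) < lik_integral N \<theta> n (far_set p Q \<theta> h) X}
    \<le> ennreal (2 * (real (card T) * exp (- real n * h\<^sup>2 / 8)))"
proof -
  let ?P = "PiM UNIV (\<lambda>_. exp_model \<theta>) :: (nat \<Rightarrow> real) measure"
  let ?A = "far_set p Q \<theta> h" and ?e = "exp (- real n * h\<^sup>2 / 8)"
  let ?cell = "\<lambda>t. ?A \<inter> coord_box k s t"
  interpret N: prob_space N by fact
  have M: "prob_space (exp_model \<theta>)" by (rule prob_space_exp_model[OF p \<theta>])
  note meas = density_ratio_measurable[OF sN, of \<theta>]
  have cell_sets: "?cell t \<in> sets N" for t by (simp add: sN)
  note L_meas = lik_integral_measurable[OF p \<theta> N sN]
  have cell: "emeasure ?P {X \<in> space ?P. ennreal ?e \<le> lik_integral N \<theta> n (?cell t) X} \<le> ennreal (2 * ?e)"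
    if t: "t \<in> T" for t
  proof -
    have tA: "t \<in> sobolev_ellipsoid p Q" "h < hellinger (exp_density \<theta>) (exp_density t)"
      using t T by (auto simp: far_set_def)
    interpret ellipsoid_pair p Q \<theta> t by unfold_locales (use p \<theta> tA in auto)
    define H where "H = hellinger f g"
    have H: "h\<^sup>2 \<le> H\<^sup>2" using tA(2) h by (auto simp: H_def intro: power_mono)
    define u where "u = exp (- real n * H\<^sup>2 / 2)"
    define c where "c = exp (- real n * H\<^sup>2 / 8)"
    have c_le: "c \<le> ?e"
      using H by (auto simp: c_def intro!: mult_left_mono)
    have ratio: "(\<integral>\<^sup>+x. ennreal (exp_density \<eta> x / f x / (g x / f x)) \<partial>exp_model \<theta>) ^ n
        \<le> ennreal (exp (real n * H\<^sup>2 / 4))" if "\<eta> \<in> ?cell t" for \<eta>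
    proof -
      have \<eta>: "\<eta> \<in> sobolev_ellipsoid p Q" using that by (simp add: far_set_def)
      have "param_dist2 \<eta> t \<le> real k * s\<^sup>2 + 4 * Q / real k ^ (2 * p)"
        using that by (intro param_dist2_le[OF k \<eta> tA(1)]) (auto simp: coord_box_def)
      then have "256 * exp (14 * log_bound Q) * param_dist2 \<eta> t
          \<le> 256 * exp (14 * log_bound Q) * (real k * s\<^sup>2 + 4 * Q / real k ^ (2 * p))"
        by (intro mult_left_mono) auto
      then have "256 * exp (14 * log_bound Q) * param_dist2 \<eta> t \<le> H\<^sup>2"
        using radius H by linarith
      then have "(\<integral>\<^sup>+x. ennreal (exp_density \<eta> x / f x / (g x / f x)) \<partial>exp_model \<theta>) \<le> ennreal (exp (H\<^sup>2 / 4))"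
        unfolding H_def by (rule cell_likelihood_ratio_le[OF p \<theta> \<eta> tA(1)])
      then have "(\<integral>\<^sup>+x. ennreal (exp_density \<eta> x / f x / (g x / f x)) \<partial>exp_model \<theta>) ^ n \<le> ennreal (exp (H\<^sup>2 / 4)) ^ n"
        by (intro power_mono) auto
      then show ?thesis by (simp add: ennreal_power exp_of_nat_mult[symmetric])
    qed
    have "emeasure ?P {X \<in> space ?P. ennreal ?e \<le> lik_integral N \<theta> n (?cell t) X}
        \<le> emeasure ?P {X \<in> space ?P. ennreal c \<le> lik_integral N \<theta> n (?cell t) X}"
      using L_meas[OF cell_sets] c_le
      by (intro emeasure_mono) (auto intro: order_trans[OF ennreal_leI])
    also have "\<dots> \<le> ennreal (1 / sqrt u) * (\<integral>\<^sup>+x. ennreal (sqrt (g x / f x)) \<partial>exp_model \<theta>) ^ n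
        + ennreal (u / c) * (\<integral>\<^sup>+\<eta>. (\<integral>\<^sup>+x. ennreal (exp_density \<eta> x / f x / (g x / f x)) \<partial>exp_model \<theta>) ^ n
            * indicator (?cell t) \<eta> \<partial>N)"
      using exp_density_pos[OF p \<theta>] exp_density_pos[OF p tA(1)]
      by (intro mixture_likelihood_upper_tail[OF M N.finite_measure_axioms meas _ cell_sets])
        (auto simp: exp_density_nonneg u_def c_def)
    also have "\<dots> \<le> ennreal (1 / sqrt u) * ennreal (exp (- H\<^sup>2 / 2)) ^ n
        + ennreal (u / c) * (\<integral>\<^sup>+\<eta>. ennreal (exp (real n * H\<^sup>2 / 4)) \<partial>N)"
      using hellinger_affinity_le ratio
      by (intro add_mono mult_left_mono power_mono nn_integral_mono) (auto simp: H_def split: split_indicator)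
    also have "\<dots> = ennreal (1 / sqrt u * exp (- H\<^sup>2 / 2) ^ n + u / c * exp (real n * H\<^sup>2 / 4))"
      by (simp add: u_def c_def ennreal_power ennreal_mult[symmetric] ennreal_plus[symmetric]
          N.emeasure_space_1 del: ennreal_plus)
    also have "\<dots> \<le> ennreal (c + c)"
    proof (rule ennreal_leI, rule add_mono)
      have "sqrt u = exp (- real n * H\<^sup>2 / 4)"
        by (rule real_sqrt_unique) (simp_all add: u_def power2_eq_square exp_add[symmetric])
      then have "1 / sqrt u = exp (real n * H\<^sup>2 / 4)"
        by (simp add: exp_minus inverse_eq_divide)
      moreover have "exp (- H\<^sup>2 / 2) ^ n = exp (real n * (- H\<^sup>2 / 2))"
        by (rule exp_of_nat_mult[symmetric])
      ultimately have "1 / sqrt u * exp (- H\<^sup>2 / 2) ^ n = exp (real n * H\<^sup>2 / 4 + real n * (- H\<^sup>2 / 2))"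
        by (simp only: exp_add)
      also have "real n * H\<^sup>2 / 4 + real n * (- H\<^sup>2 / 2) = - real n * H\<^sup>2 / 4"
        by simp
      also have "exp (- real n * H\<^sup>2 / 4) \<le> c" by (simp add: c_def)
      finally show "1 / sqrt u * exp (- H\<^sup>2 / 2) ^ n \<le> c" .
      have "u / c * exp (real n * H\<^sup>2 / 4)
          = exp (- real n * H\<^sup>2 / 2 - - real n * H\<^sup>2 / 8 + real n * H\<^sup>2 / 4)"
        unfolding u_def c_def by (simp only: exp_add exp_diff)
      also have "- real n * H\<^sup>2 / 2 - - real n * H\<^sup>2 / 8 + real n * H\<^sup>2 / 4 = - real n * H\<^sup>2 / 8"
        by simp
      finally show "u / c * exp (real n * H\<^sup>2 / 4) \<le> c"
        by (simp add: c_def)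
    qed
    also have "\<dots> \<le> ennreal (2 * ?e)" using c_le by (intro ennreal_leI) simp
    finally show ?thesis .
  qed
  have subadd: "lik_integral N \<theta> n ?A X \<le> (\<Sum>t\<in>T. lik_integral N \<theta> n (?cell t) X)" if X: "X \<in> space ?P" for X
  proof -
    have lik_meas: "(\<lambda>\<eta>. \<Prod>i<n. ennreal (exp_density \<eta> (X i) / exp_density \<theta> (X i))) \<in> borel_measurable N"
    proof (intro borel_measurable_prod_ennreal)
      fix i
      have "X i \<in> space (exp_model \<theta>)" using X by (auto simp: space_PiM)
      from measurable_compose[OF measurable_Pair2'[OF this] meas]
      show "(\<lambda>\<eta>. ennreal (exp_density \<eta> (X i) / exp_density \<theta> (X i))) \<in> borel_measurable N" by simp
    qed
    have "lik_integral N \<theta> n ?A X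
        \<le> (\<integral>\<^sup>+\<eta>. (\<Sum>t\<in>T. (\<Prod>i<n. ennreal (exp_density \<eta> (X i) / exp_density \<theta> (X i))) * indicator (?cell t) \<eta>) \<partial>N)"
    proof (rule nn_integral_mono)
      fix \<eta>
      have "(indicator ?A \<eta> :: ennreal) \<le> (\<Sum>t\<in>T. indicator (?cell t) \<eta>)"
      proof (cases "\<eta> \<in> ?A")
        case True
        then obtain t where t: "t \<in> T" "\<eta> \<in> coord_box k s t" using cover by blast
        then have "(indicator ?A \<eta> :: ennreal) \<le> indicator (?cell t) \<eta>" using True by simp
        also have "\<dots> \<le> (\<Sum>t\<in>T. indicator (?cell t) \<eta>)"
          using t(1) T(1) by (intro member_le_sum) auto
        finally show ?thesis .
      qed simp
      then show "(\<Prod>i<n. ennreal (exp_density \<eta> (X i) / exp_density \<theta> (X i))) * indicator ?A \<eta>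
          \<le> (\<Sum>t\<in>T. (\<Prod>i<n. ennreal (exp_density \<eta> (X i) / exp_density \<theta> (X i))) * indicator (?cell t) \<eta>)"
        unfolding sum_distrib_left[symmetric] by (rule mult_left_mono) simp
    qed
    also have "\<dots> = (\<Sum>t\<in>T. lik_integral N \<theta> n (?cell t) X)"
      by (intro nn_integral_sum borel_measurable_times_ennreal lik_meas borel_measurable_indicator cell_sets)
    finally show ?thesis .
  qed
  have "emeasure ?P {X \<in> space ?P. ennreal (real (card T) * ?e) < lik_integral N \<theta> n ?A X}
      \<le> emeasure ?P (\<Union>t\<in>T. {X \<in> space ?P. ennreal ?e \<le> lik_integral N \<theta> n (?cell t) X})"
  proof (rule emeasure_mono)
    show "{X \<in> space ?P. ennreal (real (card T) * ?e) < lik_integral N \<theta> n ?A X}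
        \<subseteq> (\<Union>t\<in>T. {X \<in> space ?P. ennreal ?e \<le> lik_integral N \<theta> n (?cell t) X})"
    proof (rule subsetI, rule ccontr)
      fix X assume X: "X \<in> {X \<in> space ?P. ennreal (real (card T) * ?e) < lik_integral N \<theta> n ?A X}"
        and "X \<notin> (\<Union>t\<in>T. {X \<in> space ?P. ennreal ?e \<le> lik_integral N \<theta> n (?cell t) X})"
      then have "lik_integral N \<theta> n (?cell t) X \<le> ennreal ?e" if "t \<in> T" for t
        using that by (force simp: not_le intro: less_imp_le)
      then have "(\<Sum>t\<in>T. lik_integral N \<theta> n (?cell t) X) \<le> of_nat (card T) * ennreal ?e"
        by (rule sum_bounded_above)
      also have "\<dots> = ennreal (real (card T) * ?e)"
        by (simp add: ennreal_mult ennreal_of_nat_eq_real_of_nat)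
      finally show False using subadd[of X] X by auto
    qed
  qed (use L_meas[OF cell_sets] T(1) in \<open>auto intro!: sets.finite_UN\<close>)
  also have "\<dots> \<le> (\<Sum>t\<in>T. emeasure ?P {X \<in> space ?P. ennreal ?e \<le> lik_integral N \<theta> n (?cell t) X})"
    using L_meas[OF cell_sets] T(1) by (intro emeasure_subadditive_finite) auto
  also have "\<dots> \<le> of_nat (card T) * ennreal (2 * ?e)"
    by (rule sum_bounded_above) (rule cell)
  also have "\<dots> = ennreal (2 * (real (card T) * ?e))"
    by (simp add: ennreal_mult[symmetric] ennreal_of_nat_eq_real_of_nat mult_ac)
  finally show ?thesis .
qed

lemma ball_evidence_tail:
  assumes p: "p \<ge> 1" and \<theta>: "\<theta> \<in> sobolev_ellipsoid p Q"
    and N: "prob_space N" and sN: "sets N = sets (PiM UNIV (\<lambda>_. borel))"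
    and B: "B \<in> sets N" "B \<subseteq> sobolev_ellipsoid p Q" and b: "0 < measure N B" and t: "0 < t"
    and close: "\<And>\<eta>. \<eta> \<in> B \<Longrightarrow> 4 * exp (10 * log_bound Q) * param_dist2 \<theta> \<eta> \<le> d"
  shows "emeasure (PiM UNIV (\<lambda>_. exp_model \<theta>)) {X \<in> space (PiM UNIV (\<lambda>_. exp_model \<theta>)).
      lik_integral N \<theta> n B X < ennreal (t * measure N B)} \<le> ennreal (t * exp (real n * d))"
proof -
  let ?P = "PiM UNIV (\<lambda>_. exp_model \<theta>) :: (nat \<Rightarrow> real) measure"
  interpret N: prob_space N by fact
  have M: "prob_space (exp_model \<theta>)" by (rule prob_space_exp_model[OF p \<theta>])
  have ratio: "(\<integral>\<^sup>+x. ennreal (1 / (exp_density \<eta> x / exp_density \<theta> x)) \<partial>exp_model \<theta>) ^ n \<le> ennreal (exp (real n * d))"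
    if "\<eta> \<in> B" for \<eta>
  proof -
    have "(\<integral>\<^sup>+x. ennreal (1 / (exp_density \<eta> x / exp_density \<theta> x)) \<partial>exp_model \<theta>)
        \<le> ennreal (exp (4 * exp (10 * log_bound Q) * param_dist2 \<theta> \<eta>))"
      using that B(2) by (intro chi_square_le[OF p \<theta>]) auto
    also have "\<dots> \<le> ennreal (exp d)" using close[OF that] by (intro ennreal_leI) simp
    finally have "(\<integral>\<^sup>+x. ennreal (1 / (exp_density \<eta> x / exp_density \<theta> x)) \<partial>exp_model \<theta>) ^ n \<le> ennreal (exp d) ^ n"
      by (intro power_mono) auto
    then show ?thesis by (simp add: ennreal_power exp_of_nat_mult[symmetric])
  qed
  have "emeasure ?P {X \<in> space ?P. lik_integral N \<theta> n B X < ennreal (t * measure N B)}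
      \<le> ennreal (t / measure N B) * (\<integral>\<^sup>+\<eta>. (\<integral>\<^sup>+x. ennreal (1 / (exp_density \<eta> x / exp_density \<theta> x)) \<partial>exp_model \<theta>) ^ n
          * indicator B \<eta> \<partial>N)"
    using exp_density_pos[OF p] \<theta> B(2) 
    by (intro mixture_likelihood_lower_tail[OF M N.finite_measure_axioms density_ratio_measurable[OF sN] B(1) b _ t]) auto
  also have "\<dots> \<le> ennreal (t / measure N B) * (\<integral>\<^sup>+\<eta>. ennreal (exp (real n * d)) * indicator B \<eta> \<partial>N)"
    using ratio by (intro mult_left_mono nn_integral_mono) (auto split: split_indicator)
  also have "\<dots> = ennreal (t * exp (real n * d))"
    using b t B(1) by (simp add: nn_integral_cmult N.emeasure_eq_measure ennreal_mult[symmetric])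
  finally show ?thesis .
qed

text \<open>
  Numerator and denominator are divided by the likelihood of the true parameter.  If the mixture in the
  denominator is infinite, its Bochner integral has the default value zero, and so has the quotient.
\<close>

lemma posterior_le:
  assumes p: "p \<ge> 1" and \<theta>: "\<theta> \<in> sobolev_ellipsoid p Q" and sN: "sets N = sets (PiM UNIV (\<lambda>_. borel))"
    and X: "X \<in> space (PiM UNIV (\<lambda>_. exp_model \<theta>))" and g: "0 \<le> g" and d: "0 < d"
    and num: "lik_integral N \<theta> n (far_set p Q \<theta> h) X \<le> ennreal g"
    and den: "ennreal d \<le> lik_integral N \<theta> n B X"
  defines "C \<equiv> {exp_model \<zeta> | \<zeta>. \<zeta> \<in> sobolev_ellipsoid p Q \<and> h < hellinger (exp_density \<theta>) (exp_density \<zeta>)}"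
  shows "0 \<le> posterior (sobolev_ellipsoid p Q) N n X C" "posterior (sobolev_ellipsoid p Q) N n X C \<le> g / d"
proof -
  let ?A = "far_set p Q \<theta> h"
  define F where "F = (\<Prod>i<n. exp_density \<theta> (X i))"
  let ?r = "\<lambda>\<eta>. \<Prod>i<n. exp_density \<eta> (X i) / exp_density \<theta> (X i)"
  have F: "0 < F" unfolding F_def using exp_density_pos[OF p \<theta>] by (intro prod_pos) auto
  have lik: "(\<Prod>i<n. exp_density \<eta> (X i)) = F * ?r \<eta>" for \<eta>
    using less_imp_neq[OF exp_density_pos[OF p \<theta>]] F by (simp add: F_def prod_dividef)
  have r0: "0 \<le> ?r \<eta>" for \<eta> by (intro prod_nonneg) (simp add: exp_density_nonneg)
  have [measurable]: "?r \<in> borel_measurable N"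
  proof (intro borel_measurable_prod)
    fix i
    have "X i \<in> space (exp_model \<theta>)" using X by (auto simp: space_PiM)
    from measurable_compose[OF measurable_Pair2'[OF this] density_ratio_measurable[OF sN]]
    show "(\<lambda>\<eta>. exp_density \<eta> (X i) / exp_density \<theta> (X i)) \<in> borel_measurable N" by simp
  qed
  have A [measurable]: "?A \<in> sets N" by (simp add: sN)
  have prod_ennreal: "(\<Prod>i<n. ennreal (exp_density \<eta> (X i) / exp_density \<theta> (X i))) = ennreal (?r \<eta>)" for \<eta>
    by (intro prod_ennreal) (simp add: exp_density_nonneg)
  define num where "num = (\<integral>\<eta>. indicator ?A \<eta> * ?r \<eta> \<partial>N)"
  define den where "den = (\<integral>\<eta>. ?r \<eta> \<partial>N)"
  have post: "posterior (sobolev_ellipsoid p Q) N n X C = num / den"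
  proof -
    have "(LINT \<eta>:{\<eta> \<in> sobolev_ellipsoid p Q. exp_model \<eta> \<in> C}|N. (\<Prod>i<n. exp_density \<eta> (X i))) = F * num"
      unfolding C_def far_set_eq set_lebesgue_integral_def lik num_def
      by (subst integral_mult_right_zero[symmetric]) (simp add: mult_ac)
    moreover have "(LINT \<eta>|N. (\<Prod>i<n. exp_density \<eta> (X i))) = F * den"
      unfolding lik den_def by simp
    ultimately show ?thesis using F by (simp add: posterior_def)
  qed
  have num_eq: "num = enn2real (lik_integral N \<theta> n ?A X)"
    unfolding num_def prod_ennreal using r0
    by (subst integral_eq_nn_integral) (auto simp: ennreal_mult' mult.commute ennreal_indicator intro!: arg_cong[where f=enn2real] nn_integral_cong)
  have num_le: "0 \<le> num" "num \<le> g"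
    using num g by (auto simp: num_eq intro: enn2real_leI)
  have den_eq: "den = enn2real (\<integral>\<^sup>+\<eta>. ennreal (?r \<eta>) \<partial>N)"
    unfolding den_def using r0 by (subst integral_eq_nn_integral) auto
  have "lik_integral N \<theta> n B X \<le> (\<integral>\<^sup>+\<eta>. ennreal (?r \<eta>) \<partial>N)"
    unfolding prod_ennreal by (intro nn_integral_mono) (auto split: split_indicator)
  with den have den_ge: "ennreal d \<le> (\<integral>\<^sup>+\<eta>. ennreal (?r \<eta>) \<partial>N)" by (rule order_trans)
  show "0 \<le> posterior (sobolev_ellipsoid p Q) N n X C"
    unfolding post den_eq using num_le by simp
  show "posterior (sobolev_ellipsoid p Q) N n X C \<le> g / d"
  proof (cases "(\<integral>\<^sup>+\<eta>. ennreal (?r \<eta>) \<partial>N)" rule: ennreal_cases)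
    case (real v)
    then have "d \<le> den" using den_ge d by (simp add: den_eq)
    then show ?thesis unfolding post using num_le d by (intro frac_le) auto
  next
    case top
    then show ?thesis unfolding post den_eq using g d by simp
  qed
qed

section \<open>The rate of contraction\<close>

lemma powr_inverse_power:
  assumes "1 \<le> n"
  shows "(real n powr (1 / real q)) ^ j = real n powr (real j / real q)"
  using assms by (simp add: powr_powr flip: powr_realpow)

text \<open>
  The exponential dominates the power \<open>y ^ (2 * (2 * p + 1)) = n\<^sup>2\<close>.
\<close>

lemma summable_exp_minus_root:
  "summable (\<lambda>n. exp (- (real n powr (1 / real (2 * p + 1)))))"
proof (rule summable_comparison_test'[where N=1])
  let ?m = "2 * (2 * p + 1)"
  show "summable (\<lambda>n. fact ?m * (1 / (real n)\<^sup>2))"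
    using inverse_power_summable[of 2, where 'a=real]
    by (intro summable_mult) (simp add: inverse_eq_divide)
  fix n :: nat assume n: "n \<ge> 1"
  let ?y = "real n powr (1 / real (2 * p + 1))"
  have "?y ^ ?m = real n powr (real ?m / real (2 * p + 1))"
    by (rule powr_inverse_power[OF n])
  also have "real ?m / real (2 * p + 1) = 2"
    by (simp add: field_simps)
  finally have "?y ^ ?m = (real n)\<^sup>2" using n by simp
  then have "(real n)\<^sup>2 / fact ?m \<le> exp ?y"
    using power_div_fact_le_exp[of ?y ?m] by simp
  moreover have "1 / e \<le> F * (1 / N)" if "N / F \<le> e" "0 < F" "0 < N" "0 < e" for e F N :: real
    using that by (simp add: field_simps)
  ultimately have "1 / exp ?y \<le> fact ?m * (1 / (real n)\<^sup>2)"
    using n by (simp del: fact_Suc)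
  then show "norm (exp (- ?y)) \<le> fact ?m * (1 / (real n)\<^sup>2)"
    by (simp only: exp_minus inverse_eq_divide real_norm_def abs_of_pos zero_less_divide_1_iff exp_gt_zero)
qed

text \<open>
  The constant \<open>S\<close> collects two demands on \<open>M\<^sup>2\<close>: the cells of the net must be small compared with their
  Hellinger distance from the truth, and \<open>M\<^sup>2 / 8\<close> must exceed the combined exponents of the cardinality
  of the net, the prior mass, and the lower bound on the denominator.
\<close>

lemma posterior_exponential_bound:
  fixes p :: nat and Q a \<gamma> :: real
  assumes p: "p \<ge> 1" and Q: "Q > 0" and a: "a > 0" and \<gamma>: "\<gamma> > 0"
    and lam: "\<And>k. k \<ge> 1 \<Longrightarrow> pmf lam k \<ge> a * exp (- \<gamma> * real k)"
    and \<theta>: "\<theta> \<in> sobolev_ellipsoid p Q"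
  obtains M0 where "0 < M0" and "\<And>M n. M0 \<le> M \<Longrightarrow> 1 \<le> n \<Longrightarrow>
    \<exists>Bad \<in> sets (PiM UNIV (\<lambda>_. exp_model \<theta>)).
      emeasure (PiM UNIV (\<lambda>_. exp_model \<theta>)) Bad
        \<le> ennreal (3 * exp (- (real n powr (1 / real (2 * p + 1))))) \<and>
      (\<forall>X \<in> space (PiM UNIV (\<lambda>_. exp_model \<theta>)) - Bad.
        posterior (sobolev_ellipsoid p Q) (restricted_prior p Q lam) n X
          {exp_model \<zeta> | \<zeta>. \<zeta> \<in> sobolev_ellipsoid p Q \<and>
             M * real n powr (- (real p / (2 * real p + 1))) < hellinger (exp_density \<theta>) (exp_density \<zeta>)}
        \<in> {0..exp (- (real n powr (1 / real (2 * p + 1)))) / a})"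
proof -
  let ?E = "sobolev_ellipsoid p Q" and ?N = "restricted_prior p Q lam"
  let ?P = "PiM UNIV (\<lambda>_. exp_model \<theta>) :: (nat \<Rightarrow> real) measure"
  obtain \<tau> where \<tau>: "0 < \<tau>" and small: "\<And>k \<eta>. k \<ge> 1 \<Longrightarrow> \<eta> \<in> coord_box k (box_radius p \<tau> k) \<theta> \<Longrightarrow>
      (\<And>j. j \<notin> {1..k} \<Longrightarrow> \<eta> j = 0) \<Longrightarrow> \<eta> \<in> ?E"
    using small_box_subset_ellipsoid[OF \<theta>] by metis
  obtain C where C: "0 < C" and box_mass: "\<And>k \<eta>. k \<ge> 1 \<Longrightarrow> \<eta> \<in> ?E \<Longrightarrow>
      exp (- C * real k) \<le> measure (sieve_component p k) (coord_box k (box_radius p \<tau> k) \<eta>)"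
    using sieve_box_mass[OF \<tau> Q, of p] by metis
  interpret prior: prob_space "sieve_prior p lam" by (rule prob_space_sieve_prior)
  have prior_ball: "a * exp (- (\<gamma> + C) * real k)
      \<le> measure (sieve_prior p lam) (?E \<inter> coord_box k (box_radius p \<tau> k) \<theta>)" if k: "k \<ge> 1" for k
  proof -
    have box_eq: "measure (sieve_component p k) (?E \<inter> coord_box k (box_radius p \<tau> k) \<theta>)
        = measure (sieve_component p k) (coord_box k (box_radius p \<tau> k) \<theta>)"
      by (rule sieve_component_box_eq) (rule small[OF k])
    have "a * exp (- (\<gamma> + C) * real k) = (a * exp (- \<gamma> * real k)) * exp (- C * real k)"
      by (simp add: exp_add[symmetric] algebra_simps)
    also have "\<dots> \<le> pmf lam k * measure (sieve_component p k) (?E \<inter> coord_box k (box_radius p \<tau> k) \<theta>)"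
      unfolding box_eq
      using lam[OF k] box_mass[OF k \<theta>] by (intro mult_mono) auto
    also have "\<dots> \<le> measure (sieve_prior p lam) (?E \<inter> coord_box k (box_radius p \<tau> k) \<theta>)"
      by (intro sieve_prior_mass_ge) simp
    finally show ?thesis .
  qed
  have E_pos: "0 < measure (sieve_prior p lam) ?E"
  proof -
    have "0 < a * exp (- (\<gamma> + C) * real 1)" using a by simp
    also have "\<dots> \<le> measure (sieve_prior p lam) (?E \<inter> coord_box 1 (box_radius p \<tau> 1) \<theta>)"
      by (rule prior_ball) simp
    also have "\<dots> \<le> measure (sieve_prior p lam) ?E"
      by (rule prior.finite_measure_mono) auto
    finally show ?thesis .
  qed
  have N: "prob_space ?N"
    unfolding restricted_prior_def
    using E_pos by (intro prob_space_uniform_measure) (auto simp: prior.emeasure_eq_measure)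
  have sN: "sets ?N = sets (PiM UNIV (\<lambda>_. borel))"
    by (simp add: restricted_prior_def)
  define B where "B = log_bound Q"
  define D where "D = 4 * \<tau>\<^sup>2 + 4 * Q"
  define K where "K = 4 * exp (10 * B) * D"
  define S where "S = 256 * exp (14 * B) * D + 8 * (4 * C + K + 2 * \<gamma> + 2)"
  have D: "0 < D" using \<tau> Q by (simp add: D_def add_nonneg_pos)
  have K: "0 < K" using D by (simp add: K_def)
  have S: "0 < S" using D K C \<gamma> by (simp add: S_def add_pos_pos)
  show thesis
  proof (rule that[of "1 + S"])
    show "0 < 1 + S" using S by simp
    fix M :: real and n :: nat assume M: "1 + S \<le> M" and n: "1 \<le> n"
    \<comment> \<open>The additional one in \<open>1 + S\<close> ensures \<open>M \<ge> 1\<close>, hence \<open>M\<^sup>2 \<ge> M\<close>.\<close>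
    have M2: "S \<le> M\<^sup>2"
    proof -
      have "S \<le> M" "1 \<le> M" using M S by auto
      then show ?thesis using mult_mono[of S M 1 M] by (simp add: power2_eq_square)
    qed
    have M2_radius: "256 * exp (14 * B) * D \<le> M\<^sup>2"
      using M2 C K \<gamma> by (simp add: S_def)
    have M2_rate: "4 * C + K + 2 * \<gamma> + 2 \<le> M\<^sup>2 / 8"
    proof -
      have "0 \<le> 256 * exp (14 * B) * D" using D by simp
      then have "8 * (4 * C + K + 2 * \<gamma> + 2) \<le> M\<^sup>2" using M2 unfolding S_def by linarith
      then show ?thesis by simp
    qed
    define y where "y = real n powr (1 / real (2 * p + 1))"
    define k where "k = nat \<lceil>y\<rceil>"
    define s where "s = box_radius p \<tau> k"
    define h where "h = M * real n powr (- (real p / (2 * real p + 1)))"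
    have y1: "1 \<le> y" using n by (simp add: y_def ge_one_powr_ge_zero)
    have y_pow: "y ^ j = real n powr (real j / real (2 * p + 1))" for j
      unfolding y_def by (rule powr_inverse_power[OF n])
    have yn: "y ^ (2 * p + 1) = real n"
      using n unfolding y_pow by (subst divide_self) auto
    have ky: "y \<le> real k" "real k \<le> 2 * y" and k1: "k \<ge> 1"
      using y1 of_int_ceiling_le_add_one[of y] unfolding k_def by (auto simp: le_nat_iff) linarith+
    have kpos: "0 < real k" using k1 by simp
    have h_eq: "h = M / y ^ p"
      unfolding h_def y_pow by (simp add: powr_minus divide_inverse add.commute)
    have h2: "h\<^sup>2 = M\<^sup>2 / y ^ (2 * p)"
      by (simp add: h_eq power_divide power_mult[symmetric] mult.commute)
    have ny: "real n = y ^ (2 * p) * y" using yn by (simp add: mult.commute)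
    have nh: "real n * h\<^sup>2 = M\<^sup>2 * y" using y1 by (simp add: h2 ny)
    have h0: "0 \<le> h" using M S y1 by (simp add: h_eq)
    have s0: "0 \<le> s" using \<tau> by (simp add: s_def box_radius_def)
    have ks: "real k * s\<^sup>2 = \<tau>\<^sup>2 / real k ^ (2 * p)"
      using kpos by (simp add: s_def box_radius_def power_divide)
    have kD: "D / real k ^ (2 * p) \<le> D / y ^ (2 * p)"
      using D y1 ky by (intro divide_left_mono power_mono mult_pos_pos zero_less_power) auto
    have radius_big: "real k * (2 * s)\<^sup>2 + 4 * Q / real k ^ (2 * p) = D / real k ^ (2 * p)"
      using ks by (simp add: D_def power_mult_distrib add_divide_distrib)
    have radius_small: "real k * s\<^sup>2 + 4 * Q / real k ^ (2 * p) \<le> D / real k ^ (2 * p)"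
      unfolding ks D_def add_divide_distrib by (intro add_right_mono divide_right_mono) auto

    define A where "A = far_set p Q \<theta> h"
    obtain T where T: "finite T" "T \<subseteq> A" "real (card T) \<le> exp (C * real k)"
        and cover: "\<And>\<eta>. \<eta> \<in> A \<Longrightarrow> \<exists>t\<in>T. \<eta> \<in> coord_box k (2 * s) t"
    proof (rule finite_net_of_box_mass[where A=A and c="C * real k" and p=p and k=k and s=s])
      show "exp (- (C * real k)) \<le> measure (sieve_component p k) (coord_box k s \<eta>)" if "\<eta> \<in> A" for \<eta>
        using that box_mass[OF k1, of \<eta>] by (simp add: A_def far_set_def s_def)
    qed (use s0 in auto)
    define g where "g = real (card T) * exp (- real n * h\<^sup>2 / 8)"
    define bad_num where "bad_num = {X \<in> space ?P. ennreal g < lik_integral ?N \<theta> n A X}"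
    have bad_num: "emeasure ?P bad_num \<le> ennreal (2 * g)"
      unfolding bad_num_def g_def A_def
    proof (rule far_set_evidence_tail[OF p \<theta> N sN T(1) _ h0 _ k1, where s="2 * s"])
      have "256 * exp (14 * log_bound Q) * (real k * (2 * s)\<^sup>2 + 4 * Q / real k ^ (2 * p))
          \<le> 256 * exp (14 * log_bound Q) * (D / y ^ (2 * p))"
        unfolding radius_big using kD by (intro mult_left_mono) auto
      also have "\<dots> \<le> h\<^sup>2"
        unfolding h2 using M2_radius y1 by (simp add: B_def divide_right_mono)
      finally show "256 * exp (14 * log_bound Q) * (real k * (2 * s)\<^sup>2 + 4 * Q / real k ^ (2 * p)) \<le> h\<^sup>2" .
    qed (use T cover in \<open>auto simp: A_def\<close>)
    have g_le: "g \<le> exp (- (2 * C + K + 2 * \<gamma> + 2) * y)"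
    proof -
      have "g \<le> exp (C * real k) * exp (- real n * h\<^sup>2 / 8)"
        unfolding g_def using T(3) by (intro mult_right_mono) auto
      also have "\<dots> = exp (C * real k - M\<^sup>2 / 8 * y)"
        by (simp add: exp_add[symmetric] nh)
      also have "\<dots> \<le> exp (- (2 * C + K + 2 * \<gamma> + 2) * y)"
      proof -
        have "C * real k \<le> C * (2 * y)" using ky C by (intro mult_left_mono) auto
        moreover have "(4 * C + K + 2 * \<gamma> + 2) * y \<le> M\<^sup>2 / 8 * y"
          using M2_rate y1 by (intro mult_right_mono) auto
        ultimately show ?thesis by (simp add: algebra_simps)
      qed
      finally show ?thesis .
    qed

    define Ball where "Ball = ?E \<inter> coord_box k s \<theta>"
    define b where "b = measure ?N Ball"
    \<comment> \<open>\<open>exp (K * y)\<close> bounds the expected inverse likelihood ratio; the extra \<open>exp (- y)\<close> is the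
      probability that remains.\<close>
    define t where "t = exp (- (K + 1) * y)"
    define bad_den where "bad_den = {X \<in> space ?P. lik_integral ?N \<theta> n Ball X < ennreal (t * b)}"
    have b_ge: "a * exp (- (2 * \<gamma> + 2 * C) * y) \<le> b"
    proof -
      have "(\<gamma> + C) * real k \<le> (\<gamma> + C) * (2 * y)" using ky C \<gamma> by (intro mult_left_mono) auto
      then have "a * exp (- (2 * \<gamma> + 2 * C) * y) \<le> a * exp (- (\<gamma> + C) * real k)"
        using a by (simp add: algebra_simps)
      also have "\<dots> \<le> measure (sieve_prior p lam) (?E \<inter> Ball)"
        using prior_ball[OF k1] by (simp add: Ball_def s_def)
      also have "\<dots> \<le> b"
        unfolding b_def by (rule restricted_prior_mass_ge[OF E_pos]) (simp add: Ball_def)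
      finally show ?thesis .
    qed
    have "0 < a * exp (- (2 * \<gamma> + 2 * C) * y)" using a by simp
    then have b0: "0 < b" using b_ge by (rule less_le_trans)
    have Ball_sets: "Ball \<in> sets ?N" by (simp add: Ball_def sN)
    have bad_den: "emeasure ?P bad_den \<le> ennreal (exp (- y))"
    proof -
      have "emeasure ?P bad_den \<le> ennreal (t * exp (real n * (K / y ^ (2 * p))))"
        unfolding bad_den_def b_def
      proof (rule ball_evidence_tail[OF p \<theta> N sN Ball_sets])
        fix \<eta> assume \<eta>: "\<eta> \<in> Ball"
        have "param_dist2 \<theta> \<eta> \<le> real k * s\<^sup>2 + 4 * Q / real k ^ (2 * p)"
          using \<eta> by (intro param_dist2_le[OF k1 \<theta>]) (auto simp: Ball_def coord_box_def abs_minus_commute)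
        also have "\<dots> \<le> D / y ^ (2 * p)" using radius_small kD by linarith
        finally have "4 * exp (10 * B) * param_dist2 \<theta> \<eta> \<le> 4 * exp (10 * B) * (D / y ^ (2 * p))"
          by (intro mult_left_mono) auto
        then show "4 * exp (10 * log_bound Q) * param_dist2 \<theta> \<eta> \<le> K / y ^ (2 * p)"
          by (simp add: K_def B_def)
      qed (use b0 in \<open>auto simp: Ball_def b_def t_def\<close>)
      also have "real n * (K / y ^ (2 * p)) = K * y" using y1 by (simp add: ny)
      also have "t * exp (K * y) = exp (- y)"
        unfolding t_def exp_add[symmetric] by (simp add: algebra_simps)
      finally show ?thesis .
    qed

    have sets_bad: "bad_num \<in> sets ?P" "bad_den \<in> sets ?P"
    proof -
      have "A \<in> sets ?N" by (simp add: A_def sN)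
      from lik_integral_measurable[OF p \<theta> N sN this, of n] lik_integral_measurable[OF p \<theta> N sN Ball_sets, of n]
      show "bad_num \<in> sets ?P" "bad_den \<in> sets ?P"
        unfolding bad_num_def bad_den_def by (measurable, measurable)
    qed
    have g0: "0 \<le> g" by (simp add: g_def)
    have g_exp: "g \<le> exp (- y)"
    proof -
      have "y \<le> (2 * C + K + 2 * \<gamma> + 2) * y"
        using C K \<gamma> y1 mult_right_mono[of 1 "2 * C + K + 2 * \<gamma> + 2" y] by simp
      then have "- (2 * C + K + 2 * \<gamma> + 2) * y \<le> - y"
        by (simp only: mult_minus_left neg_le_iff_le)
      then show ?thesis by (intro order_trans[OF g_le]) (simp only: exp_le_cancel_iff)
    qed
    have "emeasure ?P (bad_num \<union> bad_den) \<le> emeasure ?P bad_num + emeasure ?P bad_den"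
      by (rule emeasure_subadditive[OF sets_bad])
    also have "\<dots> \<le> ennreal (2 * g) + ennreal (exp (- y))"
      by (intro add_mono bad_num bad_den)
    also have "\<dots> = ennreal (2 * g + exp (- y))"
      using g0 by (simp add: ennreal_plus[symmetric] del: ennreal_plus)
    also have "\<dots> \<le> ennreal (3 * exp (- y))"
      using g_exp by (intro ennreal_leI) simp
    finally have prob_bad: "emeasure ?P (bad_num \<union> bad_den) \<le> ennreal (3 * exp (- y))" .
    have ratio: "g / (t * b) \<le> exp (- y) / a"
    proof -
      have "g / (t * b) \<le> exp (- (2 * C + K + 2 * \<gamma> + 2) * y) / (t * (a * exp (- (2 * \<gamma> + 2 * C) * y)))"
        using g_le b_ge a by (intro frac_le mult_left_mono) (auto simp: t_def)
      also have "t * (a * exp (- (2 * \<gamma> + 2 * C) * y)) = a * exp (- (K + 1) * y + - (2 * \<gamma> + 2 * C) * y)"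
        unfolding t_def exp_add by (simp only: mult_ac)
      also have "exp (- (2 * C + K + 2 * \<gamma> + 2) * y) / (a * exp (- (K + 1) * y + - (2 * \<gamma> + 2 * C) * y))
          = exp (- (2 * C + K + 2 * \<gamma> + 2) * y - (- (K + 1) * y + - (2 * \<gamma> + 2 * C) * y)) / a"
        unfolding exp_diff by (simp only: divide_divide_eq_left mult.commute)
      also have "- (2 * C + K + 2 * \<gamma> + 2) * y - (- (K + 1) * y + - (2 * \<gamma> + 2 * C) * y) = - y"
        by (simp add: algebra_simps)
      finally show ?thesis .
    qed
    have post: "posterior ?E ?N n X {exp_model \<zeta> | \<zeta>. \<zeta> \<in> ?E \<and> h < hellinger (exp_density \<theta>) (exp_density \<zeta>)}
        \<in> {0..exp (- y) / a}" if X: "X \<in> space ?P - (bad_num \<union> bad_den)" for X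
    proof -
      have XP: "X \<in> space ?P" and num: "lik_integral ?N \<theta> n (far_set p Q \<theta> h) X \<le> ennreal g"
        and den: "ennreal (t * b) \<le> lik_integral ?N \<theta> n Ball X"
        using X by (auto simp: bad_num_def bad_den_def A_def not_less)
      have tb: "0 < t * b" using b0 by (simp add: t_def)
      show ?thesis
        using posterior_le[OF p \<theta> sN XP g0 tb num den] ratio by (auto intro: order_trans)
    qed
    show "\<exists>Bad \<in> sets ?P. emeasure ?P Bad \<le> ennreal (3 * exp (- (real n powr (1 / real (2 * p + 1))))) \<and>
      (\<forall>X \<in> space ?P - Bad. posterior ?E ?N n X
          {exp_model \<zeta> | \<zeta>. \<zeta> \<in> ?E \<and>
             M * real n powr (- (real p / (2 * real p + 1))) < hellinger (exp_density \<theta>) (exp_density \<zeta>)}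
        \<in> {0..exp (- (real n powr (1 / real (2 * p + 1)))) / a})"
      unfolding h_def[symmetric] y_def[symmetric]
      by (intro bexI[of _ "bad_num \<union> bad_den"] conjI ballI prob_bad post sets.Un sets_bad)
  qed
qed

lemma AE_tendsto_zero_of_summable_exceptions:
  fixes f :: "nat \<Rightarrow> 'a \<Rightarrow> real"
  assumes P: "finite_measure P" and sum: "summable \<epsilon>" and lim: "\<delta> \<longlonglongrightarrow> 0"
    and bad: "\<And>n. 1 \<le> n \<Longrightarrow> \<exists>Bad \<in> sets P. emeasure P Bad \<le> ennreal (\<epsilon> n) \<and> (\<forall>x \<in> space P - Bad. f n x \<in> {0..\<delta> n})"
    and \<epsilon>: "\<And>n. 0 \<le> \<epsilon> n"
  shows "AE x in P. (\<lambda>n. f n x) \<longlonglongrightarrow> 0"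
proof -
  interpret finite_measure P by fact
  have "\<exists>Bad. \<forall>n. Bad n \<in> sets P \<and> emeasure P (Bad n) \<le> ennreal (\<epsilon> (Suc n)) \<and>
      (\<forall>x \<in> space P - Bad n. f (Suc n) x \<in> {0..\<delta> (Suc n)})"
    using bad by (intro choice allI) (metis le_add1 plus_1_eq_Suc)
  then obtain Bad where Bad: "\<And>n. Bad n \<in> sets P" "\<And>n. emeasure P (Bad n) \<le> ennreal (\<epsilon> (Suc n))"
      "\<And>n x. x \<in> space P - Bad n \<Longrightarrow> f (Suc n) x \<in> {0..\<delta> (Suc n)}" by blast
  have le: "measure P (Bad n) \<le> \<epsilon> (Suc n)" for n
    using Bad(2)[of n] \<epsilon> by (simp add: emeasure_eq_measure)
  have "summable (\<lambda>n. measure P (Bad n))"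
    by (rule summable_comparison_test'[where N=0 and g="\<lambda>n. \<epsilon> (Suc n)"])
      (use le sum in \<open>auto simp: summable_Suc_iff\<close>)
  then have "AE x in P. eventually (\<lambda>n. x \<in> space P - Bad n) sequentially"
    using Bad(1) by (intro borel_cantelli_AE1) (auto simp: emeasure_eq_measure)
  then show ?thesis
  proof (rule eventually_mono)
    fix x assume ev: "eventually (\<lambda>n. x \<in> space P - Bad n) sequentially"
    have "(\<lambda>n. f (Suc n) x) \<longlonglongrightarrow> 0"
    proof (rule tendsto_sandwich)
      have "eventually (\<lambda>n. f (Suc n) x \<in> {0..\<delta> (Suc n)}) sequentially"
        by (rule eventually_mono[OF ev]) (rule Bad(3))
      then show "eventually (\<lambda>n. 0 \<le> f (Suc n) x) sequentially" "eventually (\<lambda>n. f (Suc n) x \<le> \<delta> (Suc n)) sequentially"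
        by (auto elim!: eventually_mono)
      show "(\<lambda>n. \<delta> (Suc n)) \<longlonglongrightarrow> 0" using lim by (rule LIMSEQ_Suc)
    qed simp
    then show "(\<lambda>n. f n x) \<longlonglongrightarrow> 0" by (rule LIMSEQ_imp_Suc)
  qed
qed

theorem theorem3:
  fixes p :: nat and Q a \<gamma> :: real and lam :: "nat pmf" and \<theta>0 :: "nat \<Rightarrow> real"
  assumes "p \<ge> 1" and "Q > 0"
    and "pmf lam 0 = 0"
    and "a > 0" and "\<gamma> > 0"
    and "\<And>k. k \<ge> 1 \<Longrightarrow> pmf lam k \<ge> a * exp (- \<gamma> * real k)"
    and "\<theta>0 \<in> sobolev_ellipsoid p Q"
  shows "\<exists>M0>0. \<forall>M\<ge>M0.
    AE X in PiM (UNIV :: nat set) (\<lambda>_. exp_model \<theta>0).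
      (\<lambda>n. posterior (sobolev_ellipsoid p Q) (restricted_prior p Q lam) n X
             {exp_model \<theta> | \<theta>. \<theta> \<in> sobolev_ellipsoid p Q \<and>
                hellinger (exp_density \<theta>0) (exp_density \<theta>)
                  > M * real n powr (- (real p / (2 * real p + 1)))})
      \<longlonglongrightarrow> 0"
proof -
  let ?P = "PiM UNIV (\<lambda>_. exp_model \<theta>0) :: (nat \<Rightarrow> real) measure"
  let ?e = "\<lambda>n. exp (- (real n powr (1 / real (2 * p + 1))))"
  interpret P: prob_space ?P
    by (intro prob_space_PiM prob_space_exp_model[OF assms(1,7)])
  obtain M0 where M0: "0 < M0" and bound: "\<And>M n. M0 \<le> M \<Longrightarrow> 1 \<le> n \<Longrightarrow>
    \<exists>Bad \<in> sets ?P. emeasure ?P Bad \<le> ennreal (3 * ?e n) \<and>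
      (\<forall>X \<in> space ?P - Bad.
        posterior (sobolev_ellipsoid p Q) (restricted_prior p Q lam) n X
          {exp_model \<zeta> | \<zeta>. \<zeta> \<in> sobolev_ellipsoid p Q \<and>
             M * real n powr (- (real p / (2 * real p + 1))) < hellinger (exp_density \<theta>0) (exp_density \<zeta>)}
        \<in> {0..?e n / a})"
    using posterior_exponential_bound[OF assms(1,2,4-7)] by blast
  have sum: "summable ?e" by (rule summable_exp_minus_root)
  have lim: "(\<lambda>n. ?e n / a) \<longlonglongrightarrow> 0"
    using summable_LIMSEQ_zero[OF sum] by (rule tendsto_divide_zero)
  show ?thesis
  proof (intro exI[of _ M0] conjI M0 allI impI)
    fix M assume "M0 \<le> M"
    from bound[OF this] show "AE X in ?P.
      (\<lambda>n. posterior (sobolev_ellipsoid p Q) (restricted_prior p Q lam) n X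
             {exp_model \<theta> | \<theta>. \<theta> \<in> sobolev_ellipsoid p Q \<and>
                hellinger (exp_density \<theta>0) (exp_density \<theta>)
                  > M * real n powr (- (real p / (2 * real p + 1)))}) \<longlonglongrightarrow> 0"
      by (intro AE_tendsto_zero_of_summable_exceptions[OF P.finite_measure_axioms summable_mult[OF sum] lim]) auto
  qed
qed

end
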